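(* Let $\mathcal{C}\subseteq(\mathbb{C}^a)^{\otimes n}$ be a quantum locally recoverable code of block length $n$, dimension $k>0$, distance $d$, and locality $r$, with recovery sets $I_i$ ($i\in[n]$). Assume that $|I_i|=r$ for all $i\in[n]$, and that for all $i,j\in[n]$ either $I_i=I_j$ or $I_i\cap I_j=\emptyset$. Then \[ k \leq \left(1-\frac{2}{r}\right)n - 2\left(d-1-\left\lceil\frac{d-1}{r-1}\right\rceil\right). \]
   Context: $[n]=\{0,\dots,n-1\}$. A quantum code of block length $n$, local dimension $a$ and dimension $k$ is an $a^k$-dimensional linear subspace $\mathcal{C}\subseteq(\mathbb{C}^a)^{\otimes n}$; a code state is (the density matrix of) a unit vector in $\mathcal{C}$. For a state $\rho$ and a set of qudits $B$, $\rho_B$ is the reduced density matrix on $B$; $\mathcal{M}(A)$ denotes density matrices on qudits $A$. The code can decode from erasures in $S\subseteq[n]$ if there is a quantum channel $\mathrm{Dec}^S:\mathcal{M}([n]\setminus S)\to\mathcal{M}([n])$ with $\mathrm{Dec}^S(\psi_{[n]\setminus S})=\psi$ for every code state $\psi$; the distance $d$ is the maximum $d$ such that it can decode from erasures in every $S$ with $|S|<d$. The code is a quantum locally recoverable code of locality $r$ if for every $i\in[n]$ there is a set $I_i\subseteq[n]$ (its recovery set) with $i\in I_i$, $|I_i|\le r$, and a quantum channel $\mathrm{Rec}_i:\mathcal{M}(I_i\setminus\{i\})\to\mathcal{M}(I_i)$ such that $(\mathrm{Rec}_i\otimes\mathrm{id}_{[n]\setminus I_i})(\psi_{[n]\setminus\{i\}})=\psi$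 for every code state $\psi$. *)

theory Defs
  imports Complex_Main "HOL-Library.FuncSet"
begin

text \<open>Qudits are labelled by natural numbers. A basis configuration of the qudits in a set A
  (local dimension a) is an extensional function A \<rightarrow> [a]. Operators on the qudits A are
  complex matrices indexed by such configurations (entries outside are irrelevant).\<close>

definition cfg :: "nat \<Rightarrow> nat set \<Rightarrow> (nat \<Rightarrow> nat) set" where
  "cfg a A = (A \<rightarrow>\<^sub>E {..<a})"

type_synonym 'i op = "'i \<Rightarrow> 'i \<Rightarrow> complex"

definition psd_on :: "'i set \<Rightarrow> 'i op \<Rightarrow> bool" where
  "psd_on S X \<longleftrightarrow> (\<forall>v. Im (\<Sum>x\<in>S. \<Sum>y\<in>S. cnj (v x) * X x y * v y) = 0
                    \<and> 0 \<le> Re (\<Sum>x\<in>S. \<Sum>y\<in>S. cnj (v x) * X x y * v y))"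

definition tr_on :: "'i set \<Rightarrow> 'i op \<Rightarrow> complex" where
  "tr_on S X = (\<Sum>x\<in>S. X x x)"

definition merge :: "nat set \<Rightarrow> (nat \<Rightarrow> nat) \<Rightarrow> (nat \<Rightarrow> nat) \<Rightarrow> (nat \<Rightarrow> nat)" where
  "merge B x z = (\<lambda>i. if i \<in> B then x i else z i)"

definition ptrace :: "nat \<Rightarrow> nat set \<Rightarrow> nat set \<Rightarrow> (nat \<Rightarrow> nat) op \<Rightarrow> (nat \<Rightarrow> nat) op" where
  "ptrace a A B \<rho> = (\<lambda>x y. \<Sum>z\<in>cfg a (A - B). \<rho> (merge B x z) (merge B y z))"

definition is_channel :: "nat \<Rightarrow> nat set \<Rightarrow> nat set
     \<Rightarrow> ((nat \<Rightarrow> nat) op \<Rightarrow> (nat \<Rightarrow> nat) op) \<Rightarrow> bool" where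
  "is_channel a A B \<Phi> \<longleftrightarrow>
     (\<forall>X Y. (\<forall>x\<in>cfg a A. \<forall>y\<in>cfg a A. X x y = Y x y)
        \<longrightarrow> (\<forall>x\<in>cfg a B. \<forall>y\<in>cfg a B. \<Phi> X x y = \<Phi> Y x y)) \<and>
     (\<forall>c X Y. \<forall>x\<in>cfg a B. \<forall>y\<in>cfg a B.
        \<Phi> (\<lambda>u v. c * X u v + Y u v) x y = c * \<Phi> X x y + \<Phi> Y x y) \<and>
     (\<forall>X. tr_on (cfg a B) (\<Phi> X) = tr_on (cfg a A) X) \<and>
     (\<forall>(m::nat) X. psd_on (cfg a A \<times> {..<m}) X \<longrightarrow>
        psd_on (cfg a B \<times> {..<m}) (\<lambda>(x, i) (y, j). \<Phi> (\<lambda>u v. X (u, i) (v, j)) x y))"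

text \<open>(\<Phi> \<otimes> id_C) for a map \<Phi> : M(A) \<rightarrow> M(B), applied to an operator on A \<union> C,
  giving an operator on B \<union> C.\<close>
definition apply_on :: "nat set \<Rightarrow> nat set \<Rightarrow> nat set
     \<Rightarrow> ((nat \<Rightarrow> nat) op \<Rightarrow> (nat \<Rightarrow> nat) op) \<Rightarrow> (nat \<Rightarrow> nat) op \<Rightarrow> (nat \<Rightarrow> nat) op" where
  "apply_on A B C \<Phi> \<rho> = (\<lambda>x y. \<Phi> (\<lambda>u v. \<rho> (merge A u (restrict x C)) (merge A v (restrict y C)))
                                 (restrict x B) (restrict y B))"

text \<open>A quantum code: a linear subspace of (C^a)^{\<otimes>n} (vectors are functions on cfg a [n],
  zero elsewhere) of dimension D.\<close>
definition qcode :: "nat \<Rightarrow> nat \<Rightarrow> ((nat \<Rightarrow> nat) \<Rightarrow> complex) set \<Rightarrow> nat \<Rightarrow> bool" where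
  "qcode a n C D \<longleftrightarrow>
     (\<forall>v\<in>C. \<forall>x. x \<notin> cfg a {..<n} \<longrightarrow> v x = 0) \<and>
     (\<lambda>x. 0) \<in> C \<and>
     (\<forall>c. \<forall>v\<in>C. \<forall>w\<in>C. (\<lambda>x. c * v x + w x) \<in> C) \<and>
     (\<exists>B. finite B \<and> B \<subseteq> C \<and> card B = D \<and>
        (\<forall>c. (\<lambda>x. \<Sum>b\<in>B. c b * b x) = (\<lambda>x. 0) \<longrightarrow> (\<forall>b\<in>B. c b = 0)) \<and>
        (\<forall>v\<in>C. \<exists>c. v = (\<lambda>x. \<Sum>b\<in>B. c b * b x)))"

definition code_state :: "nat \<Rightarrow> nat \<Rightarrow> ((nat \<Rightarrow> nat) \<Rightarrow> complex) set \<Rightarrow> (nat \<Rightarrow> nat) op \<Rightarrow> bool" where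
  "code_state a n C \<psi> \<longleftrightarrow> (\<exists>v\<in>C. (\<Sum>x\<in>cfg a {..<n}. (cmod (v x))\<^sup>2) = 1 \<and>
                              \<psi> = (\<lambda>x y. v x * cnj (v y)))"

definition decodes :: "nat \<Rightarrow> nat \<Rightarrow> ((nat \<Rightarrow> nat) \<Rightarrow> complex) set \<Rightarrow> nat set \<Rightarrow> bool" where
  "decodes a n C S \<longleftrightarrow> (\<exists>Dec. is_channel a ({..<n} - S) {..<n} Dec \<and>
     (\<forall>\<psi>. code_state a n C \<psi> \<longrightarrow>
        (\<forall>x\<in>cfg a {..<n}. \<forall>y\<in>cfg a {..<n}.
           Dec (ptrace a {..<n} ({..<n} - S) \<psi>) x y = \<psi> x y)))"

definition code_distance :: "nat \<Rightarrow> nat \<Rightarrow> ((nat \<Rightarrow> nat) \<Rightarrow> complex) set \<Rightarrow> nat \<Rightarrow> bool" where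
  "code_distance a n C d \<longleftrightarrow>
     (\<forall>S. S \<subseteq> {..<n} \<and> card S < d \<longrightarrow> decodes a n C S) \<and>
     (\<forall>d'. (\<forall>S. S \<subseteq> {..<n} \<and> card S < d' \<longrightarrow> decodes a n C S) \<longrightarrow> d' \<le> d)"

definition local_recovery :: "nat \<Rightarrow> nat \<Rightarrow> ((nat \<Rightarrow> nat) \<Rightarrow> complex) set \<Rightarrow> nat \<Rightarrow> nat set \<Rightarrow> bool" where
  "local_recovery a n C i I \<longleftrightarrow> (\<exists>Rec. is_channel a (I - {i}) I Rec \<and>
     (\<forall>\<psi>. code_state a n C \<psi> \<longrightarrow>
        (\<forall>x\<in>cfg a {..<n}. \<forall>y\<in>cfg a {..<n}.
           apply_on (I - {i}) I ({..<n} - I) Rec (ptrace a {..<n} ({..<n} - {i}) \<psi>) x y = \<psi> x y)))"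

definition qlrc :: "nat \<Rightarrow> nat \<Rightarrow> ((nat \<Rightarrow> nat) \<Rightarrow> complex) set \<Rightarrow> nat \<Rightarrow> (nat \<Rightarrow> nat set) \<Rightarrow> bool" where
  "qlrc a n C r I \<longleftrightarrow> (\<forall>i<n. i \<in> I i \<and> I i \<subseteq> {..<n} \<and> card (I i) \<le> r \<and> local_recovery a n C i (I i))"

end

theory Submission
  imports Defs
begin

text \<open>
  If two disjoint sets \<open>A\<close> and \<open>B\<close> of qudits satisfy the Knill--Laflamme condition, then the code has
  dimension at most \<open>a\<close> to the number of remaining qudits. This is the quantum Singleton argument with
  ranks in place of entropies: if \<open>\<rho>\<^sub>A\<close> and \<open>\<rho>\<^sub>B\<close> are the marginals of a code vector and \<open>c\<close> is the number
  of remaining qudits, then \<open>D \<cdot> rank \<rho>\<^sub>A \<le> rank \<rho>\<^sub>B \<cdot> a^c\<close> and symmetrically, and the two bounds multiply to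
  \<open>D\<^sup>2 \<le> a^(2c)\<close>.

  A set of fewer than \<open>d\<close> qudits satisfies the condition. A qudit whose recovery set is otherwise untouched
  can always be added, since local recovery makes its state a tensor factor that is the same for all code states.
  So one may erase \<open>r - 1\<close> qudits in each of about \<open>(d - 1) / (r - 1)\<close> blocks and one qudit in every
  other block. Filling the blocks from both ends gives two such sets. Either they are disjoint, and
  counting gives the bound, or together (after trimming one of them) they exhaust all qudits, which forces \<open>D \<le> 1\<close>.
\<close>

subsection \<open>The rank form of the quantum Singleton bound\<close>

text \<open>Gaussian elimination, by induction on the equations: an unknown \<open>p\<close> with
  nonzero coefficient in equation \<open>x\<close> is eliminated from the others, which uses up one
  equation and one unknown.\<close>

lemma underdetermined:
  fixes f :: "'j \<Rightarrow> 'x \<Rightarrow> 'a::field"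
  assumes "finite X" "finite J" "card X < card J"
  shows "\<exists>c. (\<exists>j\<in>J. c j \<noteq> 0) \<and> (\<forall>x\<in>X. (\<Sum>j\<in>J. c j * f j x) = 0)"
  using assms
proof (induction X arbitrary: J f rule: finite_induct)
  case empty
  then have "J \<noteq> {}" by auto
  then show ?case by (intro exI[of _ "\<lambda>_. 1"]) auto
next
  case (insert x X)
  show ?case
  proof (cases "\<forall>j\<in>J. f j x = 0")
    case True
    have "card X < card J" using insert by simp
    from insert.IH[OF \<open>finite J\<close> this, of f] True show ?thesis by auto
  next
    case False
    then obtain p where p: "p \<in> J" "f p x \<noteq> 0" by auto
    define J' where "J' = J - {p}"
    have J: "J = insert p J'" "p \<notin> J'" "finite J'"
      using p insert.prems by (auto simp: J'_def)
    have "card X < card J'" using insert J by simp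
    from insert.IH[OF \<open>finite J'\<close> this, of "\<lambda>j y. f j y - f j x / f p x * f p y"]
    obtain c where c: "\<exists>j\<in>J'. c j \<noteq> 0"
      "\<And>y. y \<in> X \<Longrightarrow> (\<Sum>j\<in>J'. c j * (f j y - f j x / f p x * f p y)) = 0"
      by blast
    define q where "q = - (\<Sum>j\<in>J'. c j * f j x) / f p x"
    have sums: "(\<Sum>j\<in>J. (c(p := q)) j * f j y) = q * f p y + (\<Sum>j\<in>J'. c j * f j y)" for y
    proof -
      have "(\<Sum>j\<in>J'. (c(p := q)) j * f j y) = (\<Sum>j\<in>J'. c j * f j y)"
        using J by (intro sum.cong) auto
      then show ?thesis using J by simp
    qed
    have "(\<Sum>j\<in>J. (c(p := q)) j * f j y) = 0" if "y \<in> insert x X" for y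
    proof (cases "y = x")
      case True
      then show ?thesis using p by (simp only: sums) (simp add: q_def)
    next
      case False
      then have "0 = (\<Sum>j\<in>J'. c j * (f j y - f j x / f p x * f p y))"
        using c(2) that by simp
      also have "\<dots> = (\<Sum>j\<in>J'. c j * f j y) - (\<Sum>j\<in>J'. c j * f j x) / f p x * f p y"
        by (simp add: right_diff_distrib sum_subtractf sum_divide_distrib sum_distrib_left mult_ac)
      finally show ?thesis by (simp only: sums) (simp add: q_def)
    qed
    moreover have "\<exists>j\<in>J. (c(p := q)) j \<noteq> 0" using c(1) J by auto
    ultimately show ?thesis by blast
  qed
qed

text \<open>A maximal independent set of rows spans, since adding a further row creates a relation
  in which that row has a nonzero coefficient. Independence refers to row labels, so repeated rows
  need no separate treatment.\<close>

lemma row_basis_exists: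
  fixes f :: "'i \<Rightarrow> 'z \<Rightarrow> 'a::field"
  assumes "finite M"
  obtains X where "X \<subseteq> M"
    "\<And>c. (\<forall>z\<in>Z. (\<Sum>x\<in>X. c x * f x z) = 0) \<Longrightarrow> (\<forall>x\<in>X. c x = 0)"
    "\<And>y. y \<in> M \<Longrightarrow> \<exists>c. \<forall>z\<in>Z. f y z = (\<Sum>x\<in>X. c x * f x z)"
proof -
  define ind where "ind X \<longleftrightarrow> (\<forall>c. (\<forall>z\<in>Z. (\<Sum>x\<in>X. c x * f x z) = 0) \<longrightarrow> (\<forall>x\<in>X. c x = 0))" for X
  have "finite {X. X \<subseteq> M \<and> ind X}" using assms by simp
  moreover have "{} \<in> {X. X \<subseteq> M \<and> ind X}" by (simp add: ind_def)
  ultimately obtain X where X: "X \<subseteq> M" "ind X"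
    and mx: "\<And>Y. Y \<subseteq> M \<Longrightarrow> ind Y \<Longrightarrow> X \<subseteq> Y \<Longrightarrow> X = Y"
    using finite_has_maximal[of "{X. X \<subseteq> M \<and> ind X}"] by (metis (mono_tags, lifting) empty_iff mem_Collect_eq)
  have fX: "finite X" using X assms finite_subset by blast
  have "\<exists>c. \<forall>z\<in>Z. f y z = (\<Sum>x\<in>X. c x * f x z)" if y: "y \<in> M" for y
  proof (cases "y \<in> X")
    case True
    have "(\<Sum>x\<in>X. (if x = y then 1 else 0) * f x z) = f y z" for z
      using True fX by (simp add: if_distrib[of "\<lambda>t. t * _"] sum.delta cong: if_cong)
    then show ?thesis by (intro exI[of _ "\<lambda>x. if x = y then 1 else 0"]) simp
  next
    case False
    then have "\<not> ind (insert y X)" using mx[of "insert y X"] X y by blast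
    then obtain c where c: "\<And>z. z \<in> Z \<Longrightarrow> (\<Sum>x\<in>insert y X. c x * f x z) = 0" "\<exists>x\<in>insert y X. c x \<noteq> 0"
      unfolding ind_def by blast
    have c': "c y * f y z + (\<Sum>x\<in>X. c x * f x z) = 0" if "z \<in> Z" for z
      using c(1)[OF that] False fX by simp
    have "c y \<noteq> 0"
    proof
      assume "c y = 0"
      then have "\<forall>x\<in>X. c x = 0" using c' X(2) unfolding ind_def by simp
      then show False using c(2) \<open>c y = 0\<close> by auto
    qed
    have "f y z = (\<Sum>x\<in>X. - c x / c y * f x z)" if "z \<in> Z" for z
    proof -
      have "(\<Sum>x\<in>X. - c x / c y * f x z) = - (\<Sum>x\<in>X. c x * f x z) / c y"
        by (simp add: sum_divide_distrib sum_negf)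
      also have "\<dots> = f y z" proof -
        have "(\<Sum>x\<in>X. c x * f x z) = - (c y * f y z)"
          using c'[OF that] by (simp add: eq_neg_iff_add_eq_0 add.commute)
        then show ?thesis using \<open>c y \<noteq> 0\<close> by simp
      qed
      finally show ?thesis by simp
    qed
    then show ?thesis by (intro exI[of _ "\<lambda>x. - c x / c y"]) simp
  qed
  then show thesis using X(2) by (intro that[OF X(1)]) (simp_all add: ind_def)
qed

lemma sum_rotate:
  "(\<Sum>x\<in>A. \<Sum>y\<in>B. \<Sum>z\<in>D. f x y z) = (\<Sum>y\<in>B. \<Sum>z\<in>D. \<Sum>x\<in>A. f x y z)"
  by (subst sum.swap, rule sum.cong[OF refl], rule sum.swap)

lemma sum_mult_cnj_eq_0:
  assumes "finite Z" "(\<Sum>z\<in>Z. g z * cnj (g z)) = 0" "z \<in> Z"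
  shows "g z = 0"
proof -
  have "complex_of_real (\<Sum>z\<in>Z. (cmod (g z))\<^sup>2) = 0"
    using assms(2) by (simp add: complex_norm_square[symmetric])
  then have "(\<Sum>z\<in>Z. (cmod (g z))\<^sup>2) = 0" by (simp only: of_real_eq_0_iff)
  then show ?thesis using assms(1,3) by (simp add: sum_nonneg_eq_0_iff)
qed

section \<open>Configurations of subsystems\<close>

lemma finite_cfg: "finite A \<Longrightarrow> finite (cfg a A)"
  by (simp add: cfg_def finite_PiE)

lemma card_cfg: "finite A \<Longrightarrow> card (cfg a A) = a ^ card A"
  by (simp add: cfg_def card_PiE)

lemma restrict_in_cfg: "x \<in> cfg a A \<Longrightarrow> B \<subseteq> A \<Longrightarrow> restrict x B \<in> cfg a B"
  by (auto simp: cfg_def)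

lemma merge_in_cfg:
  assumes "x \<in> cfg a A" "z \<in> cfg a B" "X \<subseteq> A" "Y - X \<subseteq> B" "X \<subseteq> Y" "B \<subseteq> Y"
  shows "merge X x z \<in> cfg a Y"
  using assms unfolding cfg_def merge_def PiE_def Pi_def extensional_def by auto

lemma bij_merge:
  assumes "X \<inter> Y = {}"
  shows "bij_betw (\<lambda>(x, y). merge X x y) (cfg a X \<times> cfg a Y) (cfg a (X \<union> Y))"
proof (rule bij_betw_byWitness[where f' = "\<lambda>z. (restrict z X, restrict z Y)"])
  show "\<forall>p\<in>cfg a X \<times> cfg a Y. (\<lambda>z. (restrict z X, restrict z Y)) (case p of (x, y) \<Rightarrow> merge X x y) = p"
    using assms by (auto simp: cfg_def merge_def PiE_def extensional_def fun_eq_iff)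
  show "\<forall>z\<in>cfg a (X \<union> Y). (case (restrict z X, restrict z Y) of (x, y) \<Rightarrow> merge X x y) = z"
    by (auto simp: cfg_def merge_def PiE_def extensional_def fun_eq_iff)
  show "(\<lambda>(x, y). merge X x y) ` (cfg a X \<times> cfg a Y) \<subseteq> cfg a (X \<union> Y)"
    using assms by (auto intro!: merge_in_cfg)
  show "(\<lambda>z. (restrict z X, restrict z Y)) ` cfg a (X \<union> Y) \<subseteq> cfg a X \<times> cfg a Y"
    by (auto intro: restrict_in_cfg)
qed

lemma sum_cfg_split:
  assumes "X \<inter> Y = {}" "finite X" "finite Y"
  shows "(\<Sum>z\<in>cfg a (X \<union> Y). f z) = (\<Sum>x\<in>cfg a X. \<Sum>y\<in>cfg a Y. f (merge X x y))"
proof -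
  have "(\<Sum>z\<in>cfg a (X \<union> Y). f z) = (\<Sum>p\<in>cfg a X \<times> cfg a Y. f (case p of (x, y) \<Rightarrow> merge X x y))"
    by (rule sum.reindex_bij_betw[OF bij_merge[OF assms(1)], symmetric])
  then show ?thesis by (simp add: sum.cartesian_product case_prod_unfold)
qed

section \<open>Knill-Laflamme condition and ranks of marginals\<close>

definition outer :: "('i \<Rightarrow> complex) \<Rightarrow> ('i \<Rightarrow> complex) \<Rightarrow> 'i op" where
  "outer v w = (\<lambda>x y. v x * cnj (w y))"

text \<open>The Knill--Laflamme condition: the marginal of \<open>|v\<rangle>\<langle>w|\<close> on \<open>A\<close> depends on the code vectors
  only through their inner product.\<close>
definition correctable :: "nat \<Rightarrow> nat set \<Rightarrow> ((nat \<Rightarrow> nat) \<Rightarrow> complex) set \<Rightarrow> nat set \<Rightarrow> bool" where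
  "correctable a N C A \<longleftrightarrow> (\<exists>\<sigma>. \<forall>v\<in>C. \<forall>w\<in>C. \<forall>x\<in>cfg a A. \<forall>y\<in>cfg a A.
     ptrace a N A (outer v w) x y = tr_on (cfg a N) (outer v w) * \<sigma> x y)"

lemma tr_outer_eq_0:
  assumes "finite S" "tr_on S (outer v v) = 0" "x \<in> S"
  shows "v x = 0"
  using sum_mult_cnj_eq_0[of S v x] assms by (simp add: tr_on_def outer_def)

text \<open>Each sum is a trace times the same sesquilinear form in \<open>c\<close> and
  \<open>d\<close>, built from the operator \<open>\<sigma>\<close> of the Knill-Laflamme condition.
  Cross-multiplying removes \<open>\<sigma>\<close>, so inner products of row combinations of
  arbitrary code vectors can be read off from one fixed vector \<open>u\<close>.\<close>

lemma correctable_swap: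
  assumes "correctable a N C A" "finite X" "X \<subseteq> cfg a A" "v \<in> C" "w \<in> C" "u \<in> C"
  shows "tr_on (cfg a N) (outer u u) *
      (\<Sum>z\<in>cfg a (N - A). (\<Sum>x\<in>X. c x * v (merge A x z)) * cnj (\<Sum>x\<in>X. d x * w (merge A x z))) =
    tr_on (cfg a N) (outer v w) *
      (\<Sum>z\<in>cfg a (N - A). (\<Sum>x\<in>X. c x * u (merge A x z)) * cnj (\<Sum>x\<in>X. d x * u (merge A x z)))"
proof -
  obtain \<sigma> where \<sigma>: "\<And>v w x y. v \<in> C \<Longrightarrow> w \<in> C \<Longrightarrow> x \<in> cfg a A \<Longrightarrow> y \<in> cfg a A \<Longrightarrow>
     ptrace a N A (outer v w) x y = tr_on (cfg a N) (outer v w) * \<sigma> x y"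
    using assms(1) unfolding correctable_def by blast
  have *: "(\<Sum>z\<in>cfg a (N - A). (\<Sum>x\<in>X. c x * v (merge A x z)) * cnj (\<Sum>x\<in>X. d x * w (merge A x z)))
     = tr_on (cfg a N) (outer v w) * (\<Sum>x\<in>X. \<Sum>y\<in>X. c x * cnj (d y) * \<sigma> x y)"
    if "v \<in> C" "w \<in> C" for v w
  proof -
    have "(\<Sum>z\<in>cfg a (N - A). (\<Sum>x\<in>X. c x * v (merge A x z)) * cnj (\<Sum>x\<in>X. d x * w (merge A x z)))
      = (\<Sum>z\<in>cfg a (N - A). \<Sum>x\<in>X. \<Sum>y\<in>X. c x * cnj (d y) * (v (merge A x z) * cnj (w (merge A y z))))"
      by (simp add: sum_product mult_ac)
    also have "\<dots> = (\<Sum>x\<in>X. \<Sum>y\<in>X. \<Sum>z\<in>cfg a (N - A). c x * cnj (d y) * (v (merge A x z) * cnj (w (merge A y z))))"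
      by (rule sum_rotate)
    also have "\<dots> = (\<Sum>x\<in>X. \<Sum>y\<in>X. c x * cnj (d y) * ptrace a N A (outer v w) x y)"
      by (simp add: ptrace_def outer_def sum_distrib_left)
    also have "\<dots> = (\<Sum>x\<in>X. \<Sum>y\<in>X. tr_on (cfg a N) (outer v w) * (c x * cnj (d y) * \<sigma> x y))"
      using \<sigma> that assms(3) by (intro sum.cong refl) (auto simp: subset_iff mult_ac)
    finally show ?thesis by (simp add: sum_distrib_left)
  qed
  show ?thesis by (simp only: *[OF assms(4,5)] *[OF assms(6,6)]) (simp add: mult_ac)
qed

text \<open>By \<open>correctable_swap\<close> the squared norm of the combination for
  \<open>w\<close> is a multiple of the one for \<open>u\<close>, hence zero. Thus all code vectors
  inherit the linear relations among the rows of a single \<open>u\<close>.\<close>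

lemma correctable_relation_transfer:
  assumes "correctable a N C A" "finite N" "finite X" "X \<subseteq> cfg a A" "w \<in> C" "u \<in> C"
    and "tr_on (cfg a N) (outer u u) \<noteq> 0"
    and "\<And>z. z \<in> cfg a (N - A) \<Longrightarrow> (\<Sum>x\<in>X. c x * u (merge A x z)) = 0"
    and "z \<in> cfg a (N - A)"
  shows "(\<Sum>x\<in>X. c x * w (merge A x z)) = 0"
proof -
  have "(\<Sum>z\<in>cfg a (N - A). (\<Sum>x\<in>X. c x * w (merge A x z)) * cnj (\<Sum>x\<in>X. c x * w (merge A x z))) = 0"
    using correctable_swap[OF assms(1,3,4,5,5,6), of c c] assms(7,8) by simp
  then show ?thesis
    using sum_mult_cnj_eq_0[where g = "\<lambda>z. \<Sum>x\<in>X. c x * w (merge A x z)"] assms(2,9) finite_cfg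
    by blast
qed

text \<open>Up to the factor \<open>?t\<close>, the squared norm of the vanishing sum equals that of
  the sum over \<open>b\<close> of the product vectors with entries \<open>b y * g b z\<close>. That
  sum therefore vanishes too, and independence is used twice: of \<open>B\<close> for fixed
  \<open>z\<close>, then of the rows of \<open>u\<close>.\<close>

lemma correctable_independent:
  assumes "correctable a N C A" "finite N" "finite X" "X \<subseteq> cfg a A" "u \<in> C"
    and u: "tr_on (cfg a N) (outer u u) \<noteq> 0"
    and X: "\<And>c. (\<forall>z\<in>cfg a (N - A). (\<Sum>x\<in>X. c x * u (merge A x z)) = 0) \<Longrightarrow> (\<forall>x\<in>X. c x = 0)"
    and B: "finite B" "B \<subseteq> C" "\<And>c. (\<forall>y\<in>cfg a N. (\<Sum>b\<in>B. c b * b y) = 0) \<Longrightarrow> (\<forall>b\<in>B. c b = 0)"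
    and 0: "\<And>z. z \<in> cfg a (N - A) \<Longrightarrow> (\<Sum>b\<in>B. \<Sum>x\<in>X. c b x * b (merge A x z)) = 0"
    and bx: "b \<in> B" "x \<in> X"
  shows "c b x = 0"
proof -
  define R where "R v c z = (\<Sum>x\<in>X. c x * v (merge A x z))" for v :: "(nat \<Rightarrow> nat) \<Rightarrow> complex" and c z
  define g where "g b z = R u (c b) z" for b z
  let ?Z = "cfg a (N - A)" and ?t = "tr_on (cfg a N) (outer u u)"
  have fin: "finite ?Z" "finite (cfg a N)" using assms(2) by (simp_all add: finite_cfg)
  have sw: "?t * (\<Sum>z\<in>?Z. R v c z * cnj (R w d z)) =
      tr_on (cfg a N) (outer v w) * (\<Sum>z\<in>?Z. R u c z * cnj (R u d z))"
    if "v \<in> B" "w \<in> B" for v w c d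
    unfolding R_def using that B(2) by (intro correctable_swap[OF assms(1,3,4)] \<open>u \<in> C\<close>) auto
  have "0 = ?t * (\<Sum>z\<in>?Z. (\<Sum>b\<in>B. R b (c b) z) * cnj (\<Sum>b\<in>B. R b (c b) z))"
    using 0 by (simp add: R_def)
  also have "\<dots> = (\<Sum>b\<in>B. \<Sum>b'\<in>B. ?t * (\<Sum>z\<in>?Z. R b (c b) z * cnj (R b' (c b') z)))"
    unfolding cnj_sum sum_product unfolding sum_distrib_left by (rule sum_rotate)
  also have "\<dots> = (\<Sum>b\<in>B. \<Sum>b'\<in>B. \<Sum>y\<in>cfg a N. \<Sum>z\<in>?Z. (b y * cnj (b' y)) * (g b z * cnj (g b' z)))"
    using sw by (intro sum.cong refl) (simp add: g_def sum_product tr_on_def outer_def)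
  also have "\<dots> = (\<Sum>b\<in>B. \<Sum>b'\<in>B. \<Sum>p\<in>cfg a N \<times> ?Z. (b (fst p) * g b (snd p)) * cnj (b' (fst p) * g b' (snd p)))"
    by (simp add: sum.cartesian_product case_prod_unfold mult_ac)
  also have "\<dots> = (\<Sum>p\<in>cfg a N \<times> ?Z. (\<Sum>b\<in>B. b (fst p) * g b (snd p)) * cnj (\<Sum>b\<in>B. b (fst p) * g b (snd p)))"
    unfolding cnj_sum sum_product
    by (rule sum_rotate[symmetric])
  finally have "(\<Sum>b\<in>B. b y * g b z) = 0" if "y \<in> cfg a N" "z \<in> ?Z" for y z
    using sum_mult_cnj_eq_0[where Z = "cfg a N \<times> ?Z" and z = "(y, z)" and
      g = "\<lambda>p. \<Sum>b\<in>B. b (fst p) * g b (snd p)"] fin that by simp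
  then have "g b z = 0" if "z \<in> ?Z" for z
    using B(3)[of "\<lambda>b. g b z"] bx(1) that by (simp add: mult.commute)
  then show ?thesis using X[of "c b"] bx(2) by (simp add: g_def R_def)
qed

text \<open>The rows of \<open>u\<close> indexed by \<open>X\<close>, taken over all basis vectors in \<open>F\<close>, are independent, and each
  of them is determined by its restriction to the coordinates in \<open>Y\<close> on \<open>B\<close>.\<close>
lemma correctable_rank_bound:
  assumes "correctable a N C A" "correctable a N C B" "finite N" "A \<subseteq> N" "B \<subseteq> N" "A \<inter> B = {}"
    and X: "finite X" "X \<subseteq> cfg a A" 
      "\<And>c. (\<forall>z\<in>cfg a (N - A). (\<Sum>x\<in>X. c x * u (merge A x z)) = 0) \<Longrightarrow> (\<forall>x\<in>X. c x = 0)"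
    and Y: "finite Y" "Y \<subseteq> cfg a B" 
      "\<And>y. y \<in> cfg a B \<Longrightarrow> \<exists>c. \<forall>z\<in>cfg a (N - B). u (merge B y z) = (\<Sum>x\<in>Y. c x * u (merge B x z))"
    and u: "u \<in> C" "tr_on (cfg a N) (outer u u) \<noteq> 0"
    and F: "finite F" "F \<subseteq> C" "\<And>c. (\<forall>y\<in>cfg a N. (\<Sum>b\<in>F. c b * b y) = 0) \<Longrightarrow> (\<forall>b\<in>F. c b = 0)"
  shows "card F * card X \<le> card Y * a ^ card (N - (A \<union> B))"
proof (rule ccontr)
  let ?Z = "cfg a (N - (A \<union> B))"
  assume "\<not> ?thesis"
  \<comment> \<open>There is one unknown for each basis vector and row in \<open>X\<close>, and one
    equation for each row in \<open>Y\<close> and configuration of the remaining qudits. With too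
    few equations some nonzero combination satisfies all of them.\<close>
  then have "card (Y \<times> ?Z) < card (F \<times> X)" using assms(3) by (simp add: card_cartesian_product card_cfg)
  moreover have "finite (Y \<times> ?Z)" "finite (F \<times> X)"
    using X Y F assms(3) by (simp_all add: finite_cfg)
  ultimately obtain c where c: "\<exists>p\<in>F \<times> X. c p \<noteq> 0"
    "\<And>q. q \<in> Y \<times> ?Z \<Longrightarrow> (\<Sum>p\<in>F \<times> X. c p * fst p (merge A (snd p) (merge B (fst q) (snd q)))) = 0"
    using underdetermined[of "Y \<times> ?Z" "F \<times> X" "\<lambda>p q. fst p (merge A (snd p) (merge B (fst q) (snd q)))"]
    by blast
  have comm: "merge A x (merge B y z) = merge B y (merge A x z)" for x y z
    using assms(6) by (auto simp: merge_def fun_eq_iff)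
  have c0: "(\<Sum>b\<in>F. \<Sum>x\<in>X. c (b, x) * b (merge B y (merge A x z))) = 0" if "y \<in> Y" "z \<in> ?Z" for y z
    using c(2)[of "(y, z)"] that by (simp add: sum.cartesian_product case_prod_unfold comm)
  have c1: "(\<Sum>b\<in>F. \<Sum>x\<in>X. c (b, x) * b (merge B y (merge A x z))) = 0"
    if y: "y \<in> cfg a B" and z: "z \<in> ?Z" for y z
  proof (cases "y \<in> Y")
    case False
    obtain e where e: "\<And>z. z \<in> cfg a (N - B) \<Longrightarrow> u (merge B y z) = (\<Sum>x\<in>Y. e x * u (merge B x z))"
      using Y(3)[OF y] by blast
    \<comment> \<open>The coefficient -1 at \<open>y\<close> turns the expansion of row
      \<open>y\<close> into a homogeneous relation, the form in which it passes from
      \<open>u\<close> to all of \<open>F\<close>.\<close>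
    define e' where "e' x = (if x = y then -1 else e x)" for x
    have e': "(\<Sum>x\<in>insert y Y. e' x * v (merge B x z)) = (\<Sum>x\<in>Y. e x * v (merge B x z)) - v (merge B y z)"
      for v :: "(nat \<Rightarrow> nat) \<Rightarrow> complex" and z
    proof -
      have "(\<Sum>x\<in>Y. e' x * v (merge B x z)) = (\<Sum>x\<in>Y. e x * v (merge B x z))"
        using False by (intro sum.cong) (auto simp: e'_def)
      then show ?thesis using False Y(1) by (simp add: e'_def)
    qed
    have tr: "b (merge B y z) = (\<Sum>x\<in>Y. e x * b (merge B x z))" if "b \<in> F" "z \<in> cfg a (N - B)" for b z
    proof -
      have "(\<Sum>x\<in>insert y Y. e' x * b (merge B x z)) = 0"
      proof (rule correctable_relation_transfer[OF assms(2,3) _ _ _ u])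
        show "(\<Sum>x\<in>insert y Y. e' x * u (merge B x z)) = 0" if "z \<in> cfg a (N - B)" for z
          unfolding e' using e[OF that] by simp
      qed (use that F(2) Y(1,2) y in auto)
      then show ?thesis by (simp add: e')
    qed
    have "(\<Sum>b\<in>F. \<Sum>x\<in>X. c (b, x) * b (merge B y (merge A x z))) =
      (\<Sum>b\<in>F. \<Sum>x\<in>X. \<Sum>y'\<in>Y. e y' * (c (b, x) * b (merge B y' (merge A x z))))"
    proof (intro sum.cong refl)
      fix b x assume "b \<in> F" "x \<in> X"
      have "merge A x z \<in> cfg a (N - B)"
        using X(2) \<open>x \<in> X\<close> z assms(4,6) by (intro merge_in_cfg[of x a A z "N - (A \<union> B)"]) auto
      from tr[OF \<open>b \<in> F\<close> this]
      show "c (b, x) * b (merge B y (merge A x z)) = (\<Sum>y'\<in>Y. e y' * (c (b, x) * b (merge B y' (merge A x z))))"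
        by (simp add: sum_distrib_left mult_ac)
    qed
    also have "\<dots> = (\<Sum>y'\<in>Y. e y' * (\<Sum>b\<in>F. \<Sum>x\<in>X. c (b, x) * b (merge B y' (merge A x z))))"
      unfolding sum_distrib_left by (rule sum_rotate[symmetric])
    also have "\<dots> = 0" using c0 z by simp
    finally show ?thesis .
  qed (use c0 z in simp)
  \<comment> \<open>\<open>B\<close> and the remaining qudits make up the complement of
    \<open>A\<close>, so the combination vanishes everywhere, against
    \<open>correctable_independent\<close>.\<close>
  have zero: "(\<Sum>b\<in>F. \<Sum>x\<in>X. c (b, x) * b (merge A x z)) = 0" if z: "z \<in> cfg a (N - A)" for z
  proof -
    have "merge B (restrict z B) (restrict z (N - (A \<union> B))) = z"
      using z assms(5,6) by (auto simp: cfg_def merge_def PiE_def extensional_def fun_eq_iff)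
    moreover have "restrict z B \<in> cfg a B" "restrict z (N - (A \<union> B)) \<in> ?Z"
      using z assms(5,6) by (auto intro!: restrict_in_cfg[OF z])
    ultimately show ?thesis using c1[of "restrict z B" "restrict z (N - (A \<union> B))"] by (simp add: comm[symmetric])
  qed
  have "c (b, x) = 0" if "b \<in> F" "x \<in> X" for b x
    by (rule correctable_independent[where c = "\<lambda>b x. c (b, x)", OF assms(1,3) X(1,2) u X(3) F zero that])
  then show False using c(1) by auto
qed

lemma quantum_singleton:
  assumes AB: "correctable a N C A" "correctable a N C B" "finite N" "A \<subseteq> N" "B \<subseteq> N" "A \<inter> B = {}"
    and F: "finite F" "F \<subseteq> C" "\<And>c. (\<forall>y\<in>cfg a N. (\<Sum>b\<in>F. c b * b y) = 0) \<Longrightarrow> (\<forall>b\<in>F. c b = 0)"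
  shows "card F \<le> a ^ card (N - (A \<union> B))"
proof (cases "F = {}")
  case False
  then obtain u where uF: "u \<in> F" by blast
  then have u: "u \<in> C" using F by blast
  have u0: "tr_on (cfg a N) (outer u u) \<noteq> 0"
  proof
    assume "tr_on (cfg a N) (outer u u) = 0"
    then have "u y = 0" if "y \<in> cfg a N" for y
      using tr_outer_eq_0[OF finite_cfg[OF AB(3)]] that by blast
    then have "(\<Sum>b\<in>F. (if b = u then 1 else 0) * b y) = 0" if "y \<in> cfg a N" for y
      using that by (intro sum.neutral) auto
    then show False using F(3)[of "\<lambda>b. if b = u then 1 else 0"] uF by auto
  qed
  obtain X where X: "X \<subseteq> cfg a A"
      "\<And>c. (\<forall>z\<in>cfg a (N - A). (\<Sum>x\<in>X. c x * u (merge A x z)) = 0) \<Longrightarrow> (\<forall>x\<in>X. c x = 0)"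
      "\<And>y. y \<in> cfg a A \<Longrightarrow> \<exists>c. \<forall>z\<in>cfg a (N - A). u (merge A y z) = (\<Sum>x\<in>X. c x * u (merge A x z))"
    by (rule row_basis_exists[OF finite_cfg[OF finite_subset[OF AB(4,3)], where a = a],
      where Z = "cfg a (N - A)" and f = "\<lambda>x z. u (merge A x z)"], rule that)
  obtain Y where Y: "Y \<subseteq> cfg a B"
      "\<And>c. (\<forall>z\<in>cfg a (N - B). (\<Sum>x\<in>Y. c x * u (merge B x z)) = 0) \<Longrightarrow> (\<forall>x\<in>Y. c x = 0)"
      "\<And>y. y \<in> cfg a B \<Longrightarrow> \<exists>c. \<forall>z\<in>cfg a (N - B). u (merge B y z) = (\<Sum>x\<in>Y. c x * u (merge B x z))"
    by (rule row_basis_exists[OF finite_cfg[OF finite_subset[OF AB(5,3)], where a = a],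
      where Z = "cfg a (N - B)" and f = "\<lambda>x z. u (merge B x z)"], rule that)
  have fin: "finite X" "finite Y"
    using X(1) Y(1) AB(3,4,5) by (meson finite_cfg finite_subset)+
  define q where "q = a ^ card (N - (A \<union> B))"
  have XY: "card F * card X \<le> card Y * q"
    unfolding q_def by (rule correctable_rank_bound[OF AB fin(1) X(1,2) fin(2) Y(1,3) u u0 F])
  have "card F * card Y \<le> card X * a ^ card (N - (B \<union> A))"
    using AB(6) by (rule correctable_rank_bound[OF AB(2,1,3,5,4) _ fin(2) Y(1,2) fin(1) X(1,3) u u0 F, unfolded Int_commute[of B]])
  then have YX: "card F * card Y \<le> card X * q" by (simp add: Un_commute q_def)
  \<comment> \<open>This allows \<open>card X\<close> to be cancelled once the two rank bounds are
    multiplied; an empty row basis would force \<open>u\<close> to vanish.\<close>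
  have "X \<noteq> {}"
  proof
    assume "X = {}"
    then have z: "u (merge A y z) = 0" if "y \<in> cfg a A" "z \<in> cfg a (N - A)" for y z
      using X(3)[OF that(1)] that(2) by simp
    have "tr_on (cfg a (A \<union> (N - A))) (outer u u) = 0"
      unfolding tr_on_def outer_def using AB(3,4) z finite_subset
      by (subst sum_cfg_split) (auto intro!: sum.neutral)
    moreover have "A \<union> (N - A) = N" using AB(4) by blast
    ultimately show False using u0 by simp
  qed
  then have "card X > 0" using fin by (simp add: card_gt_0_iff)
  have "card F > 0" using False F(1) by (simp add: card_gt_0_iff)
  have "(card F * card F) * card X \<le> card F * (card Y * q)"
    using mult_le_mono2[OF XY, of "card F"] by (simp add: mult.assoc)
  also have "\<dots> \<le> (card X * q) * q"
    using mult_le_mono1[OF YX, of q] by (simp add: mult_ac)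
  finally have "(card F * card F) * card X \<le> (q * q) * card X"
    by (simp only: mult_ac)
  then have "(card F)\<^sup>2 \<le> q\<^sup>2"
    using \<open>card X > 0\<close> unfolding power2_eq_square by (simp only: mult_le_cancel2)
  then show ?thesis unfolding q_def by (simp only: power2_nat_le_eq_le)
qed simp

subsection \<open>Extensions of pure states\<close>

definition quad :: "'i set \<Rightarrow> 'i op \<Rightarrow> ('i \<Rightarrow> complex) \<Rightarrow> ('i \<Rightarrow> complex) \<Rightarrow> complex" where
  "quad S X v w = (\<Sum>x\<in>S. \<Sum>y\<in>S. cnj (v x) * X x y * w y)"

lemma psd_on_quad: "psd_on S X \<longleftrightarrow> (\<forall>v. Im (quad S X v v) = 0 \<and> 0 \<le> Re (quad S X v v))"
  by (simp add: psd_on_def quad_def)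

lemma quad_add_scaled:
  "quad S X (\<lambda>x. c * f x + g x) (\<lambda>x. c * f x + g x) =
    cnj c * c * quad S X f f + cnj c * quad S X f g + c * quad S X g f + quad S X g g"
  by (simp add: quad_def sum_distrib_left algebra_simps sum.distrib)

text \<open>The term quadratic in \<open>c\<close> drops out of the form at
  \<open>c * f + g\<close>. What remains is real-affine in \<open>c\<close> and still real and
  nonnegative, which forces its linear part to vanish.\<close>

lemma psd_kernel:
  assumes "psd_on S X" "quad S X f f = 0"
  shows "quad S X f g = 0" "quad S X g f = 0"
proof -
  define \<alpha> \<beta> q where "\<alpha> = quad S X g f" "\<beta> = quad S X f g" "q = quad S X g g"
  have *: "Im (c * \<alpha> + cnj c * \<beta> + q) = 0 \<and> 0 \<le> Re (c * \<alpha> + cnj c * \<beta> + q)" for c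
  proof -
    have "quad S X (\<lambda>x. c * f x + g x) (\<lambda>x. c * f x + g x) = c * \<alpha> + cnj c * \<beta> + q"
      using assms(2) by (simp add: quad_add_scaled \<alpha>_\<beta>_q_def)
    then show ?thesis using assms(1) unfolding psd_on_quad by metis
  qed
  have im_q: "Im q = 0" using *[of 0] by simp
  have bounded: "s = 0" if "\<And>t::real. 0 \<le> t * s + b" for s b :: real
  proof (rule ccontr)
    assume "s \<noteq> 0"
    then have "0 \<le> ((- b - 1) / s) * s + b" using that by blast
    then show False using \<open>s \<noteq> 0\<close> by simp
  qed
  \<comment> \<open>Nonnegativity along the real and the imaginary axis and reality at
    \<open>c = 1\<close> and \<open>c = \<i>\<close> give four real equations for
    \<open>\<alpha>\<close> and \<open>\<beta>\<close>.\<close>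
  have "Re \<alpha> + Re \<beta> = 0"
    by (rule bounded[of _ "Re q"]) (use *[of "of_real _"] in \<open>simp add: algebra_simps\<close>)
  moreover have "Im \<alpha> + Im \<beta> = 0" using *[of 1] im_q by simp
  moreover have "Im \<beta> - Im \<alpha> = 0"
    by (rule bounded[of _ "Re q"]) (use *[of "\<i> * of_real _"] in \<open>simp add: algebra_simps\<close>)
  moreover have "Re \<alpha> - Re \<beta> = 0" using *[of \<i>] im_q by simp
  ultimately have "\<alpha> = 0" "\<beta> = 0" by (simp_all add: complex_eq_iff)
  then show "quad S X f g = 0" "quad S X g f = 0" by (simp_all add: \<alpha>_\<beta>_q_def)
qed

text \<open>The test vector \<open>v\<close> is pushed forward along \<open>h\<close> by summing
  over fibres, which also handles indices identified by \<open>h\<close>.\<close>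

lemma psd_on_pullback:
  assumes "psd_on S X" "finite S" "finite T" "h ` T \<subseteq> S"
  shows "psd_on T (\<lambda>x y. X (h x) (h y))"
  unfolding psd_on_quad
proof
  fix v :: "_ \<Rightarrow> complex"
  define w where "w s = (\<Sum>x\<in>{x \<in> T. h x = s}. v x)" for s
  have "quad T (\<lambda>x y. X (h x) (h y)) v v =
      (\<Sum>s\<in>S. \<Sum>x\<in>{x \<in> T. h x = s}. \<Sum>t\<in>S. \<Sum>y\<in>{y \<in> T. h y = t}. cnj (v x) * X (h x) (h y) * v y)"
    unfolding quad_def by (simp only: sum.group[OF assms(3,2,4)])
  also have "\<dots> = (\<Sum>s\<in>S. \<Sum>x\<in>{x \<in> T. h x = s}. \<Sum>t\<in>S. \<Sum>y\<in>{y \<in> T. h y = t}. cnj (v x) * X s t * v y)"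
    by (intro sum.cong refl) auto
  also have "\<dots> = (\<Sum>s\<in>S. \<Sum>t\<in>S. \<Sum>x\<in>{x \<in> T. h x = s}. \<Sum>y\<in>{y \<in> T. h y = t}. cnj (v x) * X s t * v y)"
    by (intro sum.cong refl) (rule sum.swap)
  also have "\<dots> = quad S X w w"
    unfolding quad_def w_def cnj_sum unfolding sum_distrib_right unfolding sum_distrib_left by (rule refl)
  finally show "Im (quad T (\<lambda>x y. X (h x) (h y)) v v) = 0 \<and> 0 \<le> Re (quad T (\<lambda>x y. X (h x) (h y)) v v)"
    using assms(1) by (simp add: psd_on_quad)
qed

lemma psd_outer: "psd_on S (outer f f)"
  unfolding psd_on_quad
proof
  fix v
  define t where "t = (\<Sum>x\<in>S. cnj (v x) * f x)"
  have "quad S (outer f f) v v = t * cnj t"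
    by (simp add: quad_def outer_def t_def sum_product mult_ac)
  also have "\<dots> = of_real ((cmod t)\<^sup>2)" by (rule complex_norm_square[symmetric])
  finally show "Im (quad S (outer f f) v v) = 0 \<and> 0 \<le> Re (quad S (outer f f) v v)" by simp
qed

lemma sum_Times: "(\<Sum>p\<in>A \<times> B. f p) = (\<Sum>x\<in>A. \<Sum>y\<in>B. f (x, y))"
  by (simp add: sum.cartesian_product case_prod_unfold)

text \<open>The vectors \<open>\<phi> \<otimes> e\<^sub>k\<close> with \<open>\<phi>\<close> orthogonal to \<open>v\<close> lie in the kernel of \<open>G\<close>.\<close>
lemma psd_pure_marginal:
  assumes psd: "psd_on (Y \<times> K) G" and fin: "finite Y" "finite K"
    and v: "(\<Sum>y\<in>Y. v y * cnj (v y)) = 1"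
    and marg: "\<And>y y'. y \<in> Y \<Longrightarrow> y' \<in> Y \<Longrightarrow> (\<Sum>k\<in>K. G (y, k) (y', k)) = v y * cnj (v y')"
  obtains \<tau> where "\<And>y y' k k'. y \<in> Y \<Longrightarrow> y' \<in> Y \<Longrightarrow> k \<in> K \<Longrightarrow> k' \<in> K \<Longrightarrow>
    G (y, k) (y', k') = v y * cnj (v y') * \<tau> k k'"
proof -
  let ?Q = "quad (Y \<times> K) G"
  define e where "e k \<phi> = (\<lambda>(y, k'). if k' = k then \<phi> y else 0)" for k :: 'b and \<phi> :: "'a \<Rightarrow> complex"
  have Qe: "?Q (e k \<phi>) (e k' \<psi>) = (\<Sum>y\<in>Y. \<Sum>y'\<in>Y. cnj (\<phi> y) * G (y, k) (y', k') * \<psi> y')"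
    if "k \<in> K" "k' \<in> K" for k k' \<phi> \<psi>
  proof -
    have "?Q (e k \<phi>) (e k' \<psi>) = (\<Sum>y\<in>Y. \<Sum>l\<in>K. \<Sum>y'\<in>Y. \<Sum>l'\<in>K.
        if l' = k' then (if l = k then cnj (\<phi> y) * G (y, k) (y', k') * \<psi> y' else 0) else 0)"
      unfolding quad_def sum_Times by (intro sum.cong refl) (auto simp: e_def)
    also have "\<dots> = (\<Sum>y\<in>Y. \<Sum>l\<in>K. if l = k then (\<Sum>y'\<in>Y. cnj (\<phi> y) * G (y, k) (y', k') * \<psi> y') else 0)"
      using that fin by (intro sum.cong refl) (simp add: sum.delta)
    also have "\<dots> = (\<Sum>y\<in>Y. \<Sum>y'\<in>Y. cnj (\<phi> y) * G (y, k) (y', k') * \<psi> y')"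
      using that fin by (simp add: sum.delta)
    finally show ?thesis .
  qed
  \<comment> \<open>The values for the different \<open>k\<close> are nonnegative and add up to the
    form of the marginal at \<open>\<phi>\<close>, which is zero by orthogonality; hence each is
    zero.\<close>
  have null: "?Q (e k \<phi>) (e k \<phi>) = 0" if k: "k \<in> K" and orth: "(\<Sum>y\<in>Y. cnj (\<phi> y) * v y) = 0" for k \<phi>
  proof -
    have "(\<Sum>k\<in>K. ?Q (e k \<phi>) (e k \<phi>)) = (\<Sum>k\<in>K. \<Sum>y\<in>Y. \<Sum>y'\<in>Y. cnj (\<phi> y) * G (y, k) (y', k) * \<phi> y')"
      by (simp add: Qe)
    also have "\<dots> = (\<Sum>y\<in>Y. \<Sum>y'\<in>Y. cnj (\<phi> y) * (\<Sum>k\<in>K. G (y, k) (y', k)) * \<phi> y')"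
      by (subst sum_rotate) (simp add: sum_distrib_left sum_distrib_right)
    also have "\<dots> = (\<Sum>y\<in>Y. \<Sum>y'\<in>Y. cnj (\<phi> y) * (v y * cnj (v y')) * \<phi> y')"
      using marg by (intro sum.cong refl) simp
    also have "\<dots> = (\<Sum>y\<in>Y. cnj (\<phi> y) * v y) * (\<Sum>y\<in>Y. cnj (v y) * \<phi> y)"
      unfolding sum_product by (intro sum.cong refl) (simp add: mult_ac)
    also have "\<dots> = 0" using orth by simp
    finally have "(\<Sum>k\<in>K. Re (?Q (e k \<phi>) (e k \<phi>))) = 0"
      by (metis Re_sum zero_complex.sel(1))
    then have "Re (?Q (e k \<phi>) (e k \<phi>)) = 0"
      using psd fin k by (subst (asm) sum_nonneg_eq_0_iff) (auto simp: psd_on_quad)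
    moreover have "Im (?Q (e k \<phi>) (e k \<phi>)) = 0" using psd by (simp add: psd_on_quad)
    ultimately show ?thesis by (simp add: complex_eq_iff)
  qed
  define \<delta> where "\<delta> y = (\<lambda>x. if x = y then 1 else 0 :: complex)" for y :: 'a
  \<comment> \<open>The projection of the basis vector \<open>\<delta> y\<close> to the orthogonal
    complement of the unit vector \<open>v\<close>.\<close>
  define p where "p y = (\<lambda>x. \<delta> y x - cnj (v y) * v x)" for y
  have sum_\<delta>: "(\<Sum>x\<in>Y. \<delta> y x * f x) = f y" "(\<Sum>x\<in>Y. f x * \<delta> y x) = f y" "cnj (\<delta> y x) = \<delta> y x"
    if "y \<in> Y" for y x and f :: "'a \<Rightarrow> complex"
  proof -
    have "(\<Sum>x\<in>Y. \<delta> y x * f x) = (\<Sum>x\<in>Y. if x = y then f x else 0)"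
      "(\<Sum>x\<in>Y. f x * \<delta> y x) = (\<Sum>x\<in>Y. if x = y then f x else 0)"
      by (intro sum.cong refl; simp add: \<delta>_def)+
    then show "(\<Sum>x\<in>Y. \<delta> y x * f x) = f y" "(\<Sum>x\<in>Y. f x * \<delta> y x) = f y"
      using that fin by (simp_all add: sum.delta)
  qed (simp add: \<delta>_def)
  have orth: "(\<Sum>x\<in>Y. cnj (p y x) * v x) = 0" if "y \<in> Y" for y
  proof -
    have "(\<Sum>x\<in>Y. cnj (p y x) * v x) = (\<Sum>x\<in>Y. \<delta> y x * v x) - v y * (\<Sum>x\<in>Y. v x * cnj (v x))"
      unfolding sum_distrib_left sum_subtractf[symmetric]
      using that by (intro sum.cong refl) (simp add: p_def sum_\<delta>(3) algebra_simps)
    then show ?thesis using that v by (simp add: sum_\<delta>)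
  qed
  have right: "(\<Sum>x\<in>Y. \<Sum>x'\<in>Y. cnj (\<phi> x) * G (x, k) (x', k') * p y' x') = 0"
    if "y' \<in> Y" "k \<in> K" "k' \<in> K" for y' k k' \<phi>
    using psd_kernel(2)[OF psd null[OF that(3) orth[OF that(1)]], of "e k \<phi>"] that by (simp add: Qe)
  have left: "(\<Sum>x\<in>Y. \<Sum>x'\<in>Y. cnj (p y x) * G (x, k) (x', k') * \<phi> x') = 0"
    if "y \<in> Y" "k \<in> K" "k' \<in> K" for y k k' \<phi>
    using psd_kernel(1)[OF psd null[OF that(2) orth[OF that(1)]], of "e k' \<phi>"] that by (simp add: Qe)
  define B where "B k k' \<phi> \<psi> = (\<Sum>x\<in>Y. \<Sum>x'\<in>Y. cnj (\<phi> x) * G (x, k) (x', k') * \<psi> x')" for k k' \<phi> \<psi>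
  have "G (y, k) (y', k') = v y * cnj (v y') * B k k' v v"
    if y: "y \<in> Y" "y' \<in> Y" and k: "k \<in> K" "k' \<in> K" for y y' k k'
  proof -
    have "G (y, k) (y', k') = B k k' (\<delta> y) (\<delta> y')"
    proof -
      have "B k k' (\<delta> y) (\<delta> y') = (\<Sum>x\<in>Y. \<delta> y x * (\<Sum>x'\<in>Y. G (x, k) (x', k') * \<delta> y' x'))"
        using y by (simp add: B_def sum_distrib_left sum_\<delta>(3) mult.assoc)
      then show ?thesis using y by (simp add: sum_\<delta>)
    qed
    \<comment> \<open>Each basis vector is replaced by its component along \<open>v\<close>, first
      on the right and then on the left; the difference lies in the kernel.\<close>
    also have "\<dots> = B k k' (\<delta> y) (\<lambda>x. cnj (v y') * v x)"
    proof -
      have "B k k' (\<delta> y) (p y') = B k k' (\<delta> y) (\<delta> y') - B k k' (\<delta> y) (\<lambda>x. cnj (v y') * v x)"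
        by (simp add: B_def p_def right_diff_distrib sum_subtractf)
      moreover have "B k k' (\<delta> y) (p y') = 0" unfolding B_def by (rule right[OF y(2) k])
      ultimately show ?thesis by simp
    qed
    also have "\<dots> = B k k' (\<lambda>x. cnj (v y) * v x) (\<lambda>x. cnj (v y') * v x)"
    proof -
      have "B k k' (p y) \<psi> = B k k' (\<delta> y) \<psi> - B k k' (\<lambda>x. cnj (v y) * v x) \<psi>" for \<psi>
        by (simp add: B_def p_def algebra_simps sum_subtractf)
      moreover have "B k k' (p y) \<psi> = 0" for \<psi> unfolding B_def by (rule left[OF y(1) k])
      ultimately show ?thesis by (metis eq_iff_diff_eq_0)
    qed
    also have "\<dots> = v y * cnj (v y') * B k k' v v"
      by (simp add: B_def sum_distrib_left mult_ac)
    finally show ?thesis .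
  qed
  then show thesis by (rule that)
qed

text \<open>Polarization: writing \<open>t v\<close> for the factor of \<open>G v v\<close>, the parallelogram law
  for \<open>G\<close> gives \<open>t (u + w) + t (u - w) = 2 t u\<close> and \<open>= 2 t w\<close> whenever \<open>u\<close> and \<open>w\<close>
  are independent.\<close>
lemma sesquilinear_rank_one_factor:
  fixes G :: "('i \<Rightarrow> complex) \<Rightarrow> ('i \<Rightarrow> complex) \<Rightarrow> 'i \<Rightarrow> 'i \<Rightarrow> complex"
  assumes fin: "finite Y"
    and supp: "\<And>v x. v \<in> C \<Longrightarrow> x \<notin> Y \<Longrightarrow> v x = 0"
    and sub: "\<And>c v w. v \<in> C \<Longrightarrow> w \<in> C \<Longrightarrow> (\<lambda>x. c * v x + w x) \<in> C"
    and lin: "\<And>c v w z y y'. y \<in> Y \<Longrightarrow> y' \<in> Y \<Longrightarrow> G (\<lambda>x. c * v x + w x) z y y' = c * G v z y y' + G w z y y'"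
    and alin: "\<And>c v w z y y'. y \<in> Y \<Longrightarrow> y' \<in> Y \<Longrightarrow> G z (\<lambda>x. c * v x + w x) y y' = cnj c * G z v y y' + G z w y y'"
    and diag: "\<And>v. v \<in> C \<Longrightarrow> \<exists>t. \<forall>y\<in>Y. \<forall>y'\<in>Y. G v v y y' = v y * cnj (v y') * t"
  shows "\<exists>t. \<forall>v\<in>C. \<forall>w\<in>C. \<forall>y\<in>Y. \<forall>y'\<in>Y. G v w y y' = v y * cnj (w y') * t"
proof -
  obtain t where t: "\<And>v y y'. v \<in> C \<Longrightarrow> y \<in> Y \<Longrightarrow> y' \<in> Y \<Longrightarrow> G v v y y' = v y * cnj (v y') * t v"
    using diag by metis
  have expand: "G (\<lambda>x. c * v x + w x) (\<lambda>x. c * v x + w x) y y' =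
      c * cnj c * G v v y y' + c * G v w y y' + cnj c * G w v y y' + G w w y y'"
    if "y \<in> Y" "y' \<in> Y" for c v w y y'
    by (simp only: lin[OF that] alin[OF that] distrib_left mult.assoc add.assoc)
  have exp_t: "(c * v y + w y) * cnj (c * v y' + w y') * t (\<lambda>x. c * v x + w x) =
      c * cnj c * (v y * cnj (v y') * t v) + c * G v w y y' + cnj c * G w v y y' + w y * cnj (w y') * t w"
    if "v \<in> C" "w \<in> C" "y \<in> Y" "y' \<in> Y" for c v w y y'
    using expand[OF that(3,4), of c v w] t[OF sub[OF that(1,2)] that(3,4), of c] t that by simp
  \<comment> \<open>Testing with a functional \<open>\<phi>\<close> that kills \<open>v\<close> but
    not \<open>w\<close> leaves only the \<open>w\<close> term of the parallelogram law.\<close>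
  have half: "t (\<lambda>x. 1 * v x + w x) + t (\<lambda>x. - 1 * v x + w x) = 2 * t w"
    if vw: "v \<in> C" "w \<in> C" and \<phi>: "(\<Sum>y\<in>Y. \<phi> y * v y) = 0" "(\<Sum>y\<in>Y. \<phi> y * w y) \<noteq> 0" for v w \<phi>
  proof -
    define P where "P f = (\<Sum>y\<in>Y. \<Sum>y'\<in>Y. \<phi> y * cnj (\<phi> y') * f y y')" for f
    define s where "s = (\<Sum>y\<in>Y. \<phi> y * w y)"
    define t1 t2 where "t1 = t (\<lambda>x. 1 * v x + w x)" "t2 = t (\<lambda>x. - 1 * v x + w x)"
    have P_prod: "P (\<lambda>y y'. f y * cnj (g y') * k) = (\<Sum>y\<in>Y. \<phi> y * f y) * cnj (\<Sum>y\<in>Y. \<phi> y * g y) * k" for f g k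
      unfolding P_def cnj_sum sum_product unfolding sum_distrib_right
      by (intro sum.cong refl) (simp add: mult_ac)
    have "(v y + w y) * cnj (v y' + w y') * t1 + (w y - v y) * cnj (w y' - v y') * t2
        = v y * cnj (v y') * (2 * t v) + w y * cnj (w y') * (2 * t w)" if y: "y \<in> Y" "y' \<in> Y" for y y'
      using exp_t[OF vw y, of 1] exp_t[OF vw y, of "-1"] by (simp add: t1_t2_def)
    then have "P (\<lambda>y y'. (v y + w y) * cnj (v y' + w y') * t1 + (w y - v y) * cnj (w y' - v y') * t2)
        = P (\<lambda>y y'. v y * cnj (v y') * (2 * t v) + w y * cnj (w y') * (2 * t w))"
      unfolding P_def by (intro sum.cong refl) simp
    moreover have "P (\<lambda>y y'. f y y' + g y y') = P f + P g" for f g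
      by (simp add: P_def distrib_left sum.distrib)
    ultimately have "P (\<lambda>y y'. (v y + w y) * cnj (v y' + w y') * t1) + P (\<lambda>y y'. (w y - v y) * cnj (w y' - v y') * t2)
        = P (\<lambda>y y'. v y * cnj (v y') * (2 * t v)) + P (\<lambda>y y'. w y * cnj (w y') * (2 * t w))"
      by simp
    then have "s * cnj s * (t1 + t2) = s * cnj s * (2 * t w)"
      unfolding P_prod[of "\<lambda>y. v y + w y" "\<lambda>y. v y + w y"] P_prod[of "\<lambda>y. w y - v y" "\<lambda>y. w y - v y"] P_prod[of v v] P_prod[of w w]
      using \<phi>(1) by (simp add: distrib_left right_diff_distrib sum.distrib sum_subtractf s_def)
    moreover have "s \<noteq> 0" using \<phi>(2) by (simp add: s_def)
    then have "s * cnj s \<noteq> 0" by simp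
    ultimately have "t1 + t2 = 2 * t w" by (metis mult_left_cancel)
    then show ?thesis by (simp only: t1_t2_def)
  qed
  have t_scale: "t (\<lambda>x. c * u x) = t u" if u: "u \<in> C" "y \<in> Y" "u y \<noteq> 0" and "c \<noteq> 0" for u y c
  proof -
    have "(\<lambda>x. (c - 1) * u x + u x) = (\<lambda>x. c * u x)" by (simp add: fun_eq_iff algebra_simps)
    with exp_t[OF u(1) u(1) u(2,2), of "c - 1"] t[OF u(1) u(2,2)]
    have "c * cnj c * (u y * cnj (u y)) * t (\<lambda>x. c * u x) = c * cnj c * (u y * cnj (u y)) * t u"
      by (simp add: algebra_simps)
    then show ?thesis using u(3) \<open>c \<noteq> 0\<close> by simp
  qed
  \<comment> \<open>The functional is the inner product with the component of \<open>v\<close>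
    orthogonal to \<open>u\<close>. If \<open>u\<close> vanishes on \<open>Y\<close>, division by
    zero gives \<open>c = 0\<close>, which is still the right value.\<close>
  have functional: "\<exists>\<phi>. (\<Sum>y\<in>Y. \<phi> y * u y) = 0 \<and> (\<Sum>y\<in>Y. \<phi> y * v y) \<noteq> 0"
    if ind: "\<not> (\<exists>c. \<forall>y\<in>Y. v y = c * u y)" for u v :: "'i \<Rightarrow> complex"
  proof -
    define n where "n = (\<Sum>y\<in>Y. u y * cnj (u y))"
    define c where "c = (\<Sum>y\<in>Y. v y * cnj (u y)) / n"
    define p where "p y = v y - c * u y" for y
    have pu: "(\<Sum>y\<in>Y. p y * cnj (u y)) = 0"
    proof (cases "n = 0")
      case True
      then have "\<And>y. y \<in> Y \<Longrightarrow> u y = 0" unfolding n_def by (rule sum_mult_cnj_eq_0[OF fin])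
      then show ?thesis by simp
    next
      case False
      have "(\<Sum>y\<in>Y. p y * cnj (u y)) = (\<Sum>y\<in>Y. v y * cnj (u y)) - c * n"
        unfolding n_def sum_distrib_left sum_subtractf[symmetric]
        by (intro sum.cong refl) (simp add: p_def algebra_simps)
      then show ?thesis using False by (simp add: c_def)
    qed
    then have "cnj (\<Sum>y\<in>Y. p y * cnj (u y)) = 0" by simp
    then have up: "(\<Sum>y\<in>Y. cnj (p y) * u y) = 0" by simp
    have "(\<Sum>y\<in>Y. cnj (p y) * v y) = (\<Sum>y\<in>Y. p y * cnj (p y)) + c * (\<Sum>y\<in>Y. cnj (p y) * u y)"
      unfolding sum_distrib_left sum.distrib[symmetric]
      by (intro sum.cong refl) (simp add: p_def algebra_simps)
    moreover have "(\<Sum>y\<in>Y. p y * cnj (p y)) \<noteq> 0"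
    proof
      assume "(\<Sum>y\<in>Y. p y * cnj (p y)) = 0"
      then have "\<And>y. y \<in> Y \<Longrightarrow> p y = 0" by (rule sum_mult_cnj_eq_0[OF fin])
      then show False using ind by (auto simp: p_def)
    qed
    ultimately have "(\<Sum>y\<in>Y. cnj (p y) * v y) \<noteq> 0" using up by simp
    with up show ?thesis by (intro exI[of _ "\<lambda>y. cnj (p y)"]) simp
  qed
  have t_eq: "\<exists>t0. \<forall>v\<in>C. (\<exists>y\<in>Y. v y \<noteq> 0) \<longrightarrow> t v = t0"
  proof (cases "\<exists>u\<in>C. \<exists>y\<in>Y. u y \<noteq> 0")
    case True
    then obtain u y0 where u: "u \<in> C" "y0 \<in> Y" "u y0 \<noteq> 0" by blast
    have "t v = t u" if v: "v \<in> C" "y \<in> Y" "v y \<noteq> 0" for v y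
    proof (cases "\<exists>c. \<forall>y\<in>Y. v y = c * u y")
      case True
      then obtain c where c: "\<And>y. y \<in> Y \<Longrightarrow> v y = c * u y" by blast
      then have "v = (\<lambda>x. c * u x)" using supp[OF v(1)] supp[OF u(1)] by (metis mult_zero_right)
      moreover have "c \<noteq> 0" using c v by auto
      ultimately show ?thesis using t_scale[OF u] by simp
    next
      case False
      then have ind: "\<not> (\<exists>c. \<forall>y\<in>Y. v y = c * u y)" .
      have "\<not> (\<exists>c. \<forall>y\<in>Y. u y = c * v y)"
      proof
        assume "\<exists>c. \<forall>y\<in>Y. u y = c * v y"
        then obtain c where c: "\<And>y. y \<in> Y \<Longrightarrow> u y = c * v y" by blast
        then have "c \<noteq> 0" using u by auto
        then have "\<forall>y\<in>Y. v y = (1 / c) * u y" using c by simp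
        then show False using ind by blast
      qed
      from functional[OF this] obtain \<phi> where "(\<Sum>y\<in>Y. \<phi> y * v y) = 0" "(\<Sum>y\<in>Y. \<phi> y * u y) \<noteq> 0" by blast
      from half[OF v(1) u(1) this]
      have h1: "t (\<lambda>x. 1 * v x + u x) + t (\<lambda>x. - 1 * v x + u x) = 2 * t u" .
      from functional[OF ind] obtain \<phi> where "(\<Sum>y\<in>Y. \<phi> y * u y) = 0" "(\<Sum>y\<in>Y. \<phi> y * v y) \<noteq> 0" by blast
      from half[OF u(1) v(1) this]
      have h2: "t (\<lambda>x. 1 * u x + v x) + t (\<lambda>x. - 1 * u x + v x) = 2 * t v" .
      \<comment> \<open>The two uses of \<open>half\<close> involve \<open>u - v\<close> and
        \<open>v - u\<close>. Scaling by -1 identifies their factors, so \<open>2 * t u\<close> and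
        \<open>2 * t v\<close> are the same sum.\<close>
      have "\<not> (\<forall>y\<in>Y. v y = 1 * u y)" using ind by blast
      then obtain y1 where "y1 \<in> Y" "- 1 * u y1 + v y1 \<noteq> 0" by auto
      from t_scale[OF sub[OF u(1) v(1)] this, of "-1"]
      have "t (\<lambda>x. - 1 * (- 1 * u x + v x)) = t (\<lambda>x. - 1 * u x + v x)" by simp
      moreover have "(\<lambda>x. - 1 * (- 1 * u x + v x)) = (\<lambda>x. - 1 * v x + u x)"
        by (simp add: fun_eq_iff)
      ultimately have "t (\<lambda>x. - 1 * v x + u x) = t (\<lambda>x. - 1 * u x + v x)" by simp
      moreover have "(\<lambda>x. 1 * u x + v x) = (\<lambda>x. 1 * v x + u x)" by (simp add: fun_eq_iff)
      ultimately show ?thesis using h1 h2 by simp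
    qed
    then show ?thesis by blast
  qed auto
  then obtain t0 where t0: "\<And>v y. v \<in> C \<Longrightarrow> y \<in> Y \<Longrightarrow> v y \<noteq> 0 \<Longrightarrow> t v = t0" by blast
  have d: "G v v y y' = v y * cnj (v y') * t0" if "v \<in> C" "y \<in> Y" "y' \<in> Y" for v y y'
    using t[OF that] t0[OF that(1,2)] by (cases "v y = 0") auto
  \<comment> \<open>Polarization at \<open>c = 1\<close> and \<open>c = \<i>\<close> gives the sum
    and the difference of the two mixed terms, hence each of them.\<close>
  have "G v w y y' = v y * cnj (w y') * t0" if vw: "v \<in> C" "w \<in> C" "y \<in> Y" "y' \<in> Y" for v w y y'
  proof -
    have e: "(c * v y + w y) * cnj (c * v y' + w y') * t0 =
      c * cnj c * (v y * cnj (v y') * t0) + c * G v w y y' + cnj c * G w v y y' + w y * cnj (w y') * t0" for c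
      using expand[OF vw(3,4), of c v w] d[OF sub[OF vw(1,2)] vw(3,4), of c] d vw by simp
    have 1: "v y * cnj (w y') * t0 + w y * cnj (v y') * t0 = G v w y y' + G w v y y'"
      using e[of 1] by (simp add: algebra_simps)
    have "\<i> * (v y * cnj (w y') * t0) - \<i> * (w y * cnj (v y') * t0) = \<i> * G v w y y' - \<i> * G w v y y'"
      using e[of \<i>] by (simp add: algebra_simps)
    then have 2: "v y * cnj (w y') * t0 - w y * cnj (v y') * t0 = G v w y y' - G w v y y'"
      by (simp add: right_diff_distrib[symmetric])
    have "g = p" if "p + q = g + h" "p - q = g - h" for p q g h :: complex
      using that by (simp add: complex_eq_iff)
    from this[OF 1 2] show ?thesis .
  qed
  then show ?thesis by blast
qed

subsection \<open>Recovery channels and the Knill--Laflamme condition\<close>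

lemma psd_on_cong:
  assumes "\<And>x y. x \<in> S \<Longrightarrow> y \<in> S \<Longrightarrow> X x y = Y x y"
  shows "psd_on S X \<longleftrightarrow> psd_on S Y"
proof -
  have "quad S X v v = quad S Y v v" for v
    unfolding quad_def using assms by (intro sum.cong refl) simp
  then show ?thesis by (simp add: psd_on_quad)
qed

lemma channel_linear:
  "is_channel a A B \<Phi> \<Longrightarrow> x \<in> cfg a B \<Longrightarrow> y \<in> cfg a B \<Longrightarrow>
    \<Phi> (\<lambda>u v. c * X u v + Y u v) x y = c * \<Phi> X x y + \<Phi> Y x y"
  by (simp add: is_channel_def)

lemma channel_cong:
  assumes "is_channel a A B \<Phi>" "x \<in> cfg a B" "y \<in> cfg a B"
    and "\<And>u v. u \<in> cfg a A \<Longrightarrow> v \<in> cfg a A \<Longrightarrow> X u v = Y u v"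
  shows "\<Phi> X x y = \<Phi> Y x y"
proof -
  have "\<forall>X Y. (\<forall>x\<in>cfg a A. \<forall>y\<in>cfg a A. X x y = Y x y)
      \<longrightarrow> (\<forall>x\<in>cfg a B. \<forall>y\<in>cfg a B. \<Phi> X x y = \<Phi> Y x y)"
    using assms(1) unfolding is_channel_def by (elim conjE)
  with assms show ?thesis by simp
qed

lemma channel_trace: "is_channel a A B \<Phi> \<Longrightarrow> tr_on (cfg a B) (\<Phi> X) = tr_on (cfg a A) X"
  by (simp add: is_channel_def)

lemma channel_zero:
  assumes "is_channel a A B \<Phi>" "x \<in> cfg a B" "y \<in> cfg a B"
  shows "\<Phi> (\<lambda>u v. 0) x y = 0"
  using channel_linear[OF assms, of 1 "\<lambda>u v. 0" "\<lambda>u v. 0"] by simp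

lemma channel_sum:
  assumes "is_channel a A B \<Phi>" "x \<in> cfg a B" "y \<in> cfg a B" "finite Z"
  shows "\<Phi> (\<lambda>u v. \<Sum>z\<in>Z. X z u v) x y = (\<Sum>z\<in>Z. \<Phi> (X z) x y)"
  using assms(4)
proof (induction Z rule: finite_induct)
  case empty
  then show ?case using channel_zero[OF assms(1-3)] by simp
next
  case (insert z Z)
  have "(\<lambda>u v. \<Sum>z\<in>insert z Z. X z u v) = (\<lambda>u v. 1 * X z u v + (\<Sum>z\<in>Z. X z u v))"
    using insert by simp
  then show ?case using channel_linear[OF assms(1-3), of 1 "X z"] insert by simp
qed

text \<open>The recovery channel is applied to \<open>|v\<rangle>\<langle>v|\<close> with the erased qudits \<open>S\<close> kept as a reference.
  Its output extends the pure state \<open>|v\<rangle>\<langle>v|\<close>, hence is a product; tracing out \<open>I\<close> undoes the channel.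
  The case \<open>I = N\<close>, \<open>A = {}\<close> is the Knill--Laflamme condition for \<open>S\<close>.\<close>
lemma recovery_factorizes:
  assumes fin: "finite N" and SI: "S \<subseteq> I" "I \<subseteq> N"
    and supp: "\<forall>v\<in>C. \<forall>x. x \<notin> cfg a N \<longrightarrow> v x = 0"
    and sub: "\<forall>c. \<forall>v\<in>C. \<forall>w\<in>C. (\<lambda>x. c * v x + w x) \<in> C"
    and ch: "is_channel a (I - S) I \<Phi>"
    and rec: "\<forall>v\<in>C. tr_on (cfg a N) (outer v v) = 1 \<longrightarrow> (\<forall>x\<in>cfg a N. \<forall>y\<in>cfg a N.
      apply_on (I - S) I (N - I) \<Phi> (ptrace a N (N - S) (outer v v)) x y = outer v v x y)"
  shows "\<exists>\<sigma>. \<forall>A\<subseteq>N - I. \<forall>v\<in>C. \<forall>w\<in>C. \<forall>x\<in>cfg a (A \<union> S). \<forall>y\<in>cfg a (A \<union> S).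
    ptrace a N (A \<union> S) (outer v w) x y =
      ptrace a N A (outer v w) x y * \<sigma> (restrict x S) (restrict y S)"
proof -
  define E T where "E = N - I" "T = I - S"
  \<comment> \<open>The slice of \<open>v\<close> as a vector on the qudits \<open>T\<close> fed to
    the channel, with \<open>E\<close> fixed by \<open>y\<close> and the erased qudits
    \<open>S\<close> fixed by \<open>s\<close>. In \<open>G\<close> the labels \<open>s\<close> and
    \<open>s'\<close> index the reference.\<close>
  define L where "L v y s = (\<lambda>u. v (merge T u (merge E y s)))" for v :: "(nat \<Rightarrow> nat) \<Rightarrow> complex" and y s
  define G where "G v w y s y' s' = \<Phi> (outer (L v y s) (L w y' s')) (restrict y I) (restrict y' I)" for v w y s y' s'
  have ch: "is_channel a T I \<Phi>" using ch by (simp add: E_T_def)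
  have fins: "finite I" "finite S" "finite E" "finite T"
    using fin finite_subset[OF SI(2) fin] finite_subset[OF SI(1)] by (auto simp: E_T_def)
  have resI: "restrict y I \<in> cfg a I" if "y \<in> cfg a N" for y
    using that SI(2) by (rule restrict_in_cfg)
  have G_lin: "G (\<lambda>x. c * v x + w x) z y s y' s' = c * G v z y s y' s' + G w z y s y' s'"
    if "y \<in> cfg a N" "y' \<in> cfg a N" for c v w z y s y' s'
  proof -
    have "outer (L (\<lambda>x. c * v x + w x) y s) (L z y' s') =
        (\<lambda>u u'. c * outer (L v y s) (L z y' s') u u' + outer (L w y s) (L z y' s') u u')"
      by (simp add: outer_def L_def algebra_simps)
    then show ?thesis using channel_linear[OF ch resI resI] that by (simp add: G_def)
  qed
  have G_alin: "G z (\<lambda>x. c * v x + w x) y s y' s' = cnj c * G z v y s y' s' + G z w y s y' s'"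
    if "y \<in> cfg a N" "y' \<in> cfg a N" for c v w z y s y' s'
  proof -
    have "outer (L z y s) (L (\<lambda>x. c * v x + w x) y' s') =
        (\<lambda>u u'. cnj c * outer (L z y s) (L v y' s') u u' + outer (L z y s) (L w y' s') u u')"
      by (simp add: outer_def L_def algebra_simps)
    then show ?thesis using channel_linear[OF ch resI resI] that by (simp add: G_def)
  qed
  have G_psd: "psd_on (cfg a N \<times> cfg a S) (\<lambda>p q. G v v (fst p) (snd p) (fst q) (snd q))" for v
  proof -
    \<comment> \<open>Complete positivity in \<open>is_channel\<close> is stated for references
      labelled by initial segments of the naturals, so the configurations of
      \<open>E \<union> S\<close> are numbered by \<open>enc\<close>.\<close>
    define J where "J = cfg a (E \<union> S)"
    have finJ: "finite J" using fins by (simp add: J_def finite_cfg)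
    then obtain dec where dec: "bij_betw dec {..<card J} J"
      using ex_bij_betw_nat_finite[OF finJ] by (auto simp: atLeast0LessThan)
    define enc where "enc = inv_into {..<card J} dec"
    have enc: "enc j \<in> {..<card J}" "dec (enc j) = j" if "j \<in> J" for j
      using bij_betwE[OF bij_betw_inv_into[OF dec]] bij_betw_inv_into_right[OF dec] that
    by (auto simp: enc_def)
    define f where "f = (\<lambda>p. v (merge T (fst p) (dec (snd p))))"
    define h where "h = (\<lambda>p. (restrict (fst p) I, enc (merge E (fst p) (snd p))))"
    have mJ: "merge E y s \<in> J" if "y \<in> cfg a N" "s \<in> cfg a S" for y s
      unfolding J_def using that by (rule merge_in_cfg) (auto simp: E_T_def)
    have "psd_on (cfg a T \<times> {..<card J}) (outer f f)" by (rule psd_outer)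
    then have "psd_on (cfg a I \<times> {..<card J}) (\<lambda>(x, i) (y, j). \<Phi> (\<lambda>u v. outer f f (u, i) (v, j)) x y)"
      using ch unfolding is_channel_def by blast
    then have "psd_on (cfg a N \<times> cfg a S) (\<lambda>p q. (\<lambda>(x, i) (y, j). \<Phi> (\<lambda>u v. outer f f (u, i) (v, j)) x y) (h p) (h q))"
      by (rule psd_on_pullback) (auto simp: h_def fin fins finite_cfg resI enc(1)[OF mJ, simplified])
    moreover have "(\<lambda>(x, i) (y, j). \<Phi> (\<lambda>u v. outer f f (u, i) (v, j)) x y) (h p) (h q) = G v v (fst p) (snd p) (fst q) (snd q)"
      if "p \<in> cfg a N \<times> cfg a S" "q \<in> cfg a N \<times> cfg a S" for p q
    proof -
      have "dec (enc (merge E (fst p) (snd p))) = merge E (fst p) (snd p)"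
        "dec (enc (merge E (fst q) (snd q))) = merge E (fst q) (snd q)"
        using that by (auto intro!: enc(2) mJ)
      then show ?thesis by (simp add: h_def G_def L_def outer_def f_def)
    qed
    ultimately show ?thesis by (simp cong: psd_on_cong)
  qed
  have G_marg: "(\<Sum>s\<in>cfg a S. G v v y s y' s) = v y * cnj (v y')"
    if v: "v \<in> C" "tr_on (cfg a N) (outer v v) = 1" and y: "y \<in> cfg a N" "y' \<in> cfg a N" for v y y'
  proof -
    have "N - (N - S) = S" using SI by blast
    moreover have "merge (N - S) (merge T u (restrict y E)) z = merge T u (merge E y z)" for u y z
      using SI by (auto simp: merge_def E_T_def fun_eq_iff)
    ultimately have "(\<lambda>u u'. ptrace a N (N - S) (outer v v) (merge T u (restrict y E)) (merge T u' (restrict y' E)))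
        = (\<lambda>u u'. \<Sum>z\<in>cfg a S. outer (L v y z) (L v y' z) u u')"
      by (simp add: ptrace_def outer_def L_def)
    then have "apply_on T I E \<Phi> (ptrace a N (N - S) (outer v v)) y y' = (\<Sum>s\<in>cfg a S. G v v y s y' s)"
      using y by (simp add: apply_on_def channel_sum[OF ch resI resI finite_cfg[OF fins(2)]] G_def)
    then show ?thesis using rec v y by (simp add: E_T_def outer_def)
  qed
  have G_diag: "\<exists>t. \<forall>y\<in>cfg a N. \<forall>y'\<in>cfg a N. G v v y s y' s' = v y * cnj (v y') * t"
    if v: "v \<in> C" and s: "s \<in> cfg a S" "s' \<in> cfg a S" for v s s'
  proof (cases "tr_on (cfg a N) (outer v v) = 0")
    case True
    have "v = (\<lambda>x. 0)" using tr_outer_eq_0[OF finite_cfg[OF fin] True] supp v by blast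
    then have "outer (L v y s) (L v y' s') = (\<lambda>u u'. 0)" for y y' by (simp add: outer_def L_def)
    then show ?thesis using channel_zero[OF ch resI resI] \<open>v = _\<close> by (simp add: G_def)
  next
    case False
    \<comment> \<open>Recovery is given for unit vectors only, so \<open>v\<close> is rescaled to
      \<open>w\<close> and the identity is carried back.\<close>
    define r where "r = (\<Sum>x\<in>cfg a N. (cmod (v x))\<^sup>2)"
    have r: "tr_on (cfg a N) (outer v v) = of_real r"
      by (simp add: tr_on_def outer_def r_def complex_norm_square[symmetric])
    have "r \<ge> 0" by (simp add: r_def sum_nonneg)
    with False r have "r > 0" by (cases "r = 0") auto
    define c where "c = complex_of_real (1 / sqrt r)"
    have c: "c * cnj c = of_real (1 / r)" "c \<noteq> 0"
      using \<open>r > 0\<close> by (simp_all add: c_def flip: of_real_mult)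
    define w where "w = (\<lambda>x. (c - 1) * v x + v x)"
    have w: "w \<in> C" "w x = c * v x" for x
      using sub v unfolding w_def by blast (simp add: left_diff_distrib)
    have "tr_on (cfg a N) (outer w w) = c * cnj c * tr_on (cfg a N) (outer v v)"
      by (simp add: tr_on_def outer_def w(2) sum_distrib_left mult_ac)
    then have w1: "tr_on (cfg a N) (outer w w) = 1"
      using \<open>r > 0\<close> unfolding c r by (simp flip: of_real_mult)
    obtain \<tau> where \<tau>: "\<And>y y' s s'. y \<in> cfg a N \<Longrightarrow> y' \<in> cfg a N \<Longrightarrow> s \<in> cfg a S \<Longrightarrow> s' \<in> cfg a S \<Longrightarrow>
        G w w y s y' s' = w y * cnj (w y') * \<tau> s s'"
      using psd_pure_marginal[OF G_psd[of w] finite_cfg[OF fin] finite_cfg[OF fins(2)], of w]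
        w1 G_marg[OF w(1) w1] by (auto simp: tr_on_def outer_def)
    have "G v v y s y' s' = v y * cnj (v y') * \<tau> s s'" if y: "y \<in> cfg a N" "y' \<in> cfg a N" for y y'
    proof -
      have "G w w y s y' s' = c * cnj c * G v v y s y' s'"
        unfolding w_def G_lin[OF y] G_alin[OF y] by (simp add: algebra_simps)
      then have "c * cnj c * G v v y s y' s' = c * cnj c * (v y * cnj (v y') * \<tau> s s')"
        using \<tau>[OF y s] by (simp only: w(2) complex_cnj_mult mult_ac)
      moreover have "c * cnj c \<noteq> 0" using c(2) by simp
      ultimately show ?thesis by (metis mult_left_cancel)
    qed
    then show ?thesis by blast
  qed
  \<comment> \<open>\<open>G_diag\<close> gives a factor for each \<open>v\<close>;
    \<open>sesquilinear_rank_one_factor\<close> makes it one number for all pairs, so it depends on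
    \<open>s\<close> and \<open>s'\<close> alone.\<close>
  define \<tau> where "\<tau> s s' = (SOME t. \<forall>v\<in>C. \<forall>w\<in>C. \<forall>y\<in>cfg a N. \<forall>y'\<in>cfg a N. G v w y s y' s' = v y * cnj (w y') * t)" for s s'
  have G: "G v w y s y' s' = v y * cnj (w y') * \<tau> s s'"
    if "s \<in> cfg a S" "s' \<in> cfg a S" "v \<in> C" "w \<in> C" "y \<in> cfg a N" "y' \<in> cfg a N" for v w y y' s s'
  proof -
    have "\<exists>t. \<forall>v\<in>C. \<forall>w\<in>C. \<forall>y\<in>cfg a N. \<forall>y'\<in>cfg a N. G v w y s y' s' = v y * cnj (w y') * t"
      by (rule sesquilinear_rank_one_factor[where G = "\<lambda>v w y y'. G v w y s y' s'"])
         (use supp sub in \<open>simp_all add: finite_cfg fin G_lin G_alin G_diag that\<close>)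
    from someI_ex[OF this] that show ?thesis unfolding \<tau>_def by blast
  qed
  show ?thesis
  proof (intro exI[of _ \<tau>] allI impI ballI)
    fix A v w x y
    assume A: "A \<subseteq> N - I" and vw: "v \<in> C" "w \<in> C" and xy: "x \<in> cfg a (A \<union> S)" "y \<in> cfg a (A \<union> S)"
    have finA: "finite (E - A)" using fins by simp
    have sets: "N - (A \<union> S) = (E - A) \<union> T" "N - A = (E - A) \<union> I" "(E - A) \<inter> T = {}" "(E - A) \<inter> I = {}"
      using A SI by (auto simp: E_T_def)
    have mE: "merge A z e \<in> cfg a E" if "z \<in> cfg a (A \<union> S)" "e \<in> cfg a (E - A)" for z e
      using that by (rule merge_in_cfg) (use A in \<open>auto simp: E_T_def\<close>)
    have mN: "merge E z q \<in> cfg a N" if "z \<in> cfg a E" "q \<in> cfg a I" for z q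
      using that by (rule merge_in_cfg) (use SI in \<open>auto simp: E_T_def\<close>)
    have resS: "restrict z S \<in> cfg a S" if "z \<in> cfg a (A \<union> S)" for z
      using that by (rule restrict_in_cfg) simp
    have m1: "merge (A \<union> S) z (merge (E - A) e u) = merge T u (merge E (merge A z e) (restrict z S))"
      if "z \<in> cfg a (A \<union> S)" "e \<in> cfg a (E - A)" "u \<in> cfg a T" for z e u
      using that A SI by (auto simp: merge_def E_T_def fun_eq_iff cfg_def PiE_def extensional_def)
    have m2: "merge A z (merge (E - A) e q) = merge E (merge A z e) q" for z e q
      using A by (auto simp: merge_def E_T_def fun_eq_iff)
    have resI': "restrict (merge E z q) I = q" if "q \<in> cfg a I" for z q
      using that by (auto simp: merge_def E_T_def fun_eq_iff cfg_def PiE_def extensional_def)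
    have L': "L f (merge E z q) s = L f z s" for f z q s
      by (auto simp: L_def merge_def fun_eq_iff intro!: arg_cong[of _ _ f])
    define sx sy where "sx = restrict x S" "sy = restrict y S"
    have "ptrace a N (A \<union> S) (outer v w) x y =
        (\<Sum>e\<in>cfg a (E - A). \<Sum>u\<in>cfg a T. outer v w (merge (A \<union> S) x (merge (E - A) e u)) (merge (A \<union> S) y (merge (E - A) e u)))"
      unfolding ptrace_def sets by (rule sum_cfg_split[OF sets(3) finA fins(4)])
    also have "\<dots> = (\<Sum>e\<in>cfg a (E - A). tr_on (cfg a T) (outer (L v (merge A x e) sx) (L w (merge A y e) sy)))"
      unfolding tr_on_def using xy by (intro sum.cong refl) (simp add: m1 outer_def L_def sx_sy_def)
    \<comment> \<open>Trace preservation replaces the trace over \<open>T\<close> by one over the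
      output qudits \<open>I\<close>, where \<open>G\<close> has product form.\<close>
    also have "\<dots> = (\<Sum>e\<in>cfg a (E - A). \<Sum>q\<in>cfg a I. G v w (merge E (merge A x e) q) sx (merge E (merge A y e) q) sy)"
      unfolding channel_trace[OF ch, symmetric] unfolding tr_on_def
      by (intro sum.cong refl) (simp add: G_def resI' L')
    also have "\<dots> = (\<Sum>e\<in>cfg a (E - A). \<Sum>q\<in>cfg a I. outer v w (merge A x (merge (E - A) e q)) (merge A y (merge (E - A) e q)) * \<tau> sx sy)"
      using xy vw by (intro sum.cong refl) (simp add: m2 outer_def G mN mE sx_sy_def resS)
    also have "\<dots> = ptrace a N A (outer v w) x y * \<tau> sx sy"
      unfolding ptrace_def sets sum_cfg_split[OF sets(4) finA fins(1)] by (simp add: sum_distrib_right)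
    finally show "ptrace a N (A \<union> S) (outer v w) x y = ptrace a N A (outer v w) x y * \<tau> (restrict x S) (restrict y S)"
      by (simp add: sx_sy_def)
  qed
qed

lemma ptrace_empty: "ptrace a N {} X x y = tr_on (cfg a N) X"
  by (simp add: ptrace_def tr_on_def merge_def)

lemma correctable_empty: "correctable a N C {}"
  unfolding correctable_def by (intro exI[of _ "\<lambda>_ _. 1"]) (simp add: ptrace_empty)

lemma code_stateI: "v \<in> C \<Longrightarrow> tr_on (cfg a {..<n}) (outer v v) = 1 \<Longrightarrow> code_state a n C (outer v v)"
proof -
  assume v: "v \<in> C" "tr_on (cfg a {..<n}) (outer v v) = 1"
  have "tr_on (cfg a {..<n}) (outer v v) = complex_of_real (\<Sum>x\<in>cfg a {..<n}. (cmod (v x))\<^sup>2)"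
    by (simp add: tr_on_def outer_def complex_norm_square[symmetric])
  with v(2) have "(\<Sum>x\<in>cfg a {..<n}. (cmod (v x))\<^sup>2) = 1" by (metis of_real_eq_1_iff)
  with v(1) show ?thesis unfolding code_state_def outer_def by blast
qed

lemma qcode_supp: "qcode a n C D \<Longrightarrow> \<forall>v\<in>C. \<forall>x. x \<notin> cfg a {..<n} \<longrightarrow> v x = 0"
  and qcode_closed: "qcode a n C D \<Longrightarrow> \<forall>c. \<forall>v\<in>C. \<forall>w\<in>C. (\<lambda>x. c * v x + w x) \<in> C"
  by (simp_all add: qcode_def)

lemma decodes_correctable:
  assumes code: "qcode a n C D" and S: "S \<subseteq> {..<n}" and dec: "decodes a n C S"
  shows "correctable a {..<n} C S"
proof -
  let ?N = "{..<n}"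
  obtain Dec where ch: "is_channel a (?N - S) ?N Dec" and
    Dec: "\<And>\<psi> x y. code_state a n C \<psi> \<Longrightarrow> x \<in> cfg a ?N \<Longrightarrow> y \<in> cfg a ?N \<Longrightarrow>
      Dec (ptrace a ?N (?N - S) \<psi>) x y = \<psi> x y"
    using dec unfolding decodes_def by blast
  \<comment> \<open>The decoder is viewed as a recovery whose region is the whole register, leaving
    no idle qudits.\<close>
  have "apply_on (?N - S) ?N (?N - ?N) Dec (ptrace a ?N (?N - S) (outer v v)) x y = outer v v x y"
    if v: "v \<in> C" "tr_on (cfg a ?N) (outer v v) = 1" and xy: "x \<in> cfg a ?N" "y \<in> cfg a ?N" for v x y
  proof -
    let ?\<rho> = "ptrace a ?N (?N - S) (outer v v)"
    have r: "restrict x ?N = x" if "x \<in> cfg a ?N" for x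
      using that by (auto simp: cfg_def)
    have m: "merge (?N - S) u (restrict x {}) = u" if "u \<in> cfg a (?N - S)" for u x
      using that by (auto simp: cfg_def merge_def fun_eq_iff PiE_def extensional_def)
    have "apply_on (?N - S) ?N (?N - ?N) Dec ?\<rho> x y =
        Dec (\<lambda>u u'. ?\<rho> (merge (?N - S) u (restrict x {})) (merge (?N - S) u' (restrict y {}))) x y"
      using xy by (simp add: apply_on_def r)
    also have "\<dots> = Dec ?\<rho> x y"
      by (rule channel_cong[OF ch xy]) (simp add: m)
    also have "\<dots> = outer v v x y" by (rule Dec[OF code_stateI[OF v] xy])
    finally show ?thesis .
  qed
  then obtain \<sigma> where "\<forall>A\<subseteq>?N - ?N. \<forall>v\<in>C. \<forall>w\<in>C. \<forall>x\<in>cfg a (A \<union> S). \<forall>y\<in>cfg a (A \<union> S).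
      ptrace a ?N (A \<union> S) (outer v w) x y =
        ptrace a ?N A (outer v w) x y * \<sigma> (restrict x S) (restrict y S)"
    using recovery_factorizes[OF finite_lessThan S subset_refl qcode_supp[OF code] qcode_closed[OF code] ch] by blast
  then have "\<forall>v\<in>C. \<forall>w\<in>C. \<forall>x\<in>cfg a S. \<forall>y\<in>cfg a S. ptrace a ?N S (outer v w) x y =
      tr_on (cfg a ?N) (outer v w) * \<sigma> (restrict x S) (restrict y S)"
    by (auto simp: ptrace_empty dest: spec[of _ "{}"])
  then show ?thesis unfolding correctable_def by (intro exI[of _ "\<lambda>x y. \<sigma> (restrict x S) (restrict y S)"])
qed

text \<open>With \<open>S = {i}\<close>, \<open>recovery_factorizes\<close> makes the marginal on
  \<open>A \<union> {i}\<close> the marginal on \<open>A\<close> times a fixed operator on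
  \<open>i\<close>. Inserting the Knill-Laflamme form on \<open>A\<close> leaves the inner product
  as the only dependence on the code vectors.\<close>

lemma local_recovery_correctable:
  assumes code: "qcode a n C D" and I: "i \<in> I" "I \<subseteq> {..<n}" and rec: "local_recovery a n C i I"
    and A: "A \<subseteq> {..<n} - I" "correctable a {..<n} C A"
  shows "correctable a {..<n} C (A \<union> {i})"
proof -
  let ?N = "{..<n}"
  obtain Rec where ch: "is_channel a (I - {i}) I Rec" and
    Rec: "\<And>\<psi> x y. code_state a n C \<psi> \<Longrightarrow> x \<in> cfg a ?N \<Longrightarrow> y \<in> cfg a ?N \<Longrightarrow>
      apply_on (I - {i}) I (?N - I) Rec (ptrace a ?N (?N - {i}) \<psi>) x y = \<psi> x y"
    using rec unfolding local_recovery_def by blast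
  have "{i} \<subseteq> I" using I by simp
  have "apply_on (I - {i}) I (?N - I) Rec (ptrace a ?N (?N - {i}) (outer v v)) x y = outer v v x y"
    if "v \<in> C" "tr_on (cfg a ?N) (outer v v) = 1" "x \<in> cfg a ?N" "y \<in> cfg a ?N" for v x y
    using Rec[OF code_stateI] that .
  then obtain \<sigma> where \<sigma>: "\<forall>A\<subseteq>?N - I. \<forall>v\<in>C. \<forall>w\<in>C. \<forall>x\<in>cfg a (A \<union> {i}). \<forall>y\<in>cfg a (A \<union> {i}).
      ptrace a ?N (A \<union> {i}) (outer v w) x y =
        ptrace a ?N A (outer v w) x y * \<sigma> (restrict x {i}) (restrict y {i})"
    using recovery_factorizes[OF finite_lessThan \<open>{i} \<subseteq> I\<close> I(2) qcode_supp[OF code] qcode_closed[OF code] ch] by blast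
  obtain \<rho> where \<rho>: "\<And>v w x y. v \<in> C \<Longrightarrow> w \<in> C \<Longrightarrow> x \<in> cfg a A \<Longrightarrow> y \<in> cfg a A \<Longrightarrow>
     ptrace a ?N A (outer v w) x y = tr_on (cfg a ?N) (outer v w) * \<rho> x y"
    using A(2) unfolding correctable_def by blast
  have res: "ptrace a ?N A X x y = ptrace a ?N A X (restrict x A) (restrict y A)" for X x y
    unfolding ptrace_def by (intro sum.cong refl arg_cong2[of _ _ _ _ X]) (auto simp: merge_def fun_eq_iff)
  have "ptrace a ?N (A \<union> {i}) (outer v w) x y = tr_on (cfg a ?N) (outer v w) *
      (\<rho> (restrict x A) (restrict y A) * \<sigma> (restrict x {i}) (restrict y {i}))"
    if "v \<in> C" "w \<in> C" "x \<in> cfg a (A \<union> {i})" "y \<in> cfg a (A \<union> {i})" for v w x y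
    using \<sigma>[rule_format, OF A(1) that] res[of "outer v w" x y]
      \<rho>[OF that(1,2) restrict_in_cfg[OF that(3) Un_upper1] restrict_in_cfg[OF that(4) Un_upper1]]
    by (simp only: mult.assoc)
  then show ?thesis unfolding correctable_def
    by (intro exI[of _ "\<lambda>x y. \<rho> (restrict x A) (restrict y A) * \<sigma> (restrict x {i}) (restrict y {i})"]) blast
qed

subsection \<open>Selecting erasures block by block\<close>

lemma qcode_singleton_bound:
  assumes code: "qcode a n C D" and "correctable a {..<n} C A" "correctable a {..<n} C B"
    and "A \<subseteq> {..<n}" "B \<subseteq> {..<n}" "A \<inter> B = {}"
  shows "D \<le> a ^ card ({..<n} - (A \<union> B))"
proof -
  obtain F where F: "finite F" "F \<subseteq> C" "card F = D"
    and ind: "\<And>c. (\<lambda>x. \<Sum>b\<in>F. c b * b x) = (\<lambda>x. 0) \<Longrightarrow> (\<forall>b\<in>F. c b = 0)"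
    using code unfolding qcode_def by blast
  have "\<forall>b\<in>F. c b = 0" if "\<forall>y\<in>cfg a {..<n}. (\<Sum>b\<in>F. c b * b y) = 0" for c
  proof (rule ind, rule ext)
    fix x
    show "(\<Sum>b\<in>F. c b * b x) = 0"
    proof (cases "x \<in> cfg a {..<n}")
      case False
      show ?thesis
      proof (rule sum.neutral, rule ballI)
        fix b assume "b \<in> F"
        then have "b x = 0" using qcode_supp[OF code] F(2) False by blast
        then show "c b * b x = 0" by simp
      qed
    qed (use that in simp)
  qed
  then show ?thesis
    using quantum_singleton[OF assms(2,3) finite_lessThan assms(4-6) F(1,2)] F(3) by simp
qed

text \<open>Numbering the blocks and the qudits inside each gives a grid of \<open>m\<close> blocks
  by \<open>r\<close> positions, in which erasures can be described one block at a time.\<close>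

lemma uniform_partition_enumeration:
  fixes I :: "nat \<Rightarrow> nat set"
  assumes block: "\<And>i. i < n \<Longrightarrow> i \<in> I i \<and> I i \<subseteq> {..<n} \<and> card (I i) = r"
    and disj: "\<And>i j. i < n \<Longrightarrow> j < n \<Longrightarrow> I i = I j \<or> I i \<inter> I j = {}"
  obtains m h where "n = m * r" "bij_betw h ({..<m} \<times> {..<r}) {..<n}"
    "\<And>g x. g < m \<Longrightarrow> x < r \<Longrightarrow> I (h (g, x)) = h ` ({g} \<times> {..<r})"
proof -
  define m where "m = card (I ` {..<n})"
  have "finite (I ` {..<n})" by simp
  from ex_bij_betw_nat_finite[OF this] obtain b where b: "bij_betw b {..<m} (I ` {..<n})"
    by (auto simp: m_def atLeast0LessThan)
  have "\<exists>e. bij_betw e {..<r} (b g)" if "g < m" for g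
  proof -
    obtain i where i: "i < n" "b g = I i" using bij_betwE[OF b] \<open>g < m\<close> by blast
    then have "finite (b g)" using block finite_subset by (metis finite_lessThan)
    from ex_bij_betw_nat_finite[OF this] show ?thesis
      using i block[of i] by (auto simp: atLeast0LessThan)
  qed
  then obtain e where e: "\<And>g. g < m \<Longrightarrow> bij_betw (e g) {..<r} (b g)" by metis
  define h where "h = (\<lambda>(g, x). e g x)"
  have in_b: "h (g, x) \<in> b g" if "g < m" "x < r" for g x
    using bij_betwE[OF e[OF that(1)]] that by (simp add: h_def)
  have I_b: "I i = b g" "i < n" if "g < m" "i \<in> b g" for g i
  proof -
    obtain j where j: "j < n" "b g = I j" using bij_betwE[OF b] \<open>g < m\<close> by blast
    then show "i < n" using block that by blast
    then show "I i = b g" using disj[OF _ j(1), of i] block that j by blast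
  qed
  have bij: "bij_betw h ({..<m} \<times> {..<r}) {..<n}"
    unfolding bij_betw_def
  proof
    show "inj_on h ({..<m} \<times> {..<r})"
    proof (rule inj_onI)
      fix u v assume "u \<in> {..<m} \<times> {..<r}" "v \<in> {..<m} \<times> {..<r}" "h u = h v"
      moreover obtain g x g' x' where uv: "u = (g, x)" "v = (g', x')" by (metis surj_pair)
      ultimately have *: "g \<in> {..<m}" "x \<in> {..<r}" "g' \<in> {..<m}" "x' \<in> {..<r}" "h (g, x) = h (g', x')"
        by auto
      then have "b g = b g'" using I_b(1) in_b by (metis lessThan_iff)
      then have "g = g'" using b * by (auto simp: bij_betw_def inj_on_def)
      then show "u = v"
        using e[of g] * unfolding uv by (auto simp: bij_betw_def inj_on_def h_def)
    qed
    show "h ` ({..<m} \<times> {..<r}) = {..<n}"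
    proof (intro equalityI subsetI)
      fix i assume "i \<in> h ` ({..<m} \<times> {..<r})"
      then show "i \<in> {..<n}" using in_b I_b(2) by auto
    next
      fix i assume "i \<in> {..<n}"
      then have "I i \<in> b ` {..<m}" using b by (simp add: bij_betw_def)
      then obtain g where g: "g < m" "I i = b g" by auto
      then have "i \<in> e g ` {..<r}" using e[OF g(1)] block \<open>i \<in> {..<n}\<close> by (auto simp: bij_betw_def)
      then show "i \<in> h ` ({..<m} \<times> {..<r})" using g(1) by (force simp: h_def)
    qed
  qed
  show thesis
  proof (rule that[OF _ bij])
    show "n = m * r" using bij_betw_same_card[OF bij] by (simp add: card_cartesian_product)
    fix g x assume gx: "g < m" "x < r"
    have "h ` ({g} \<times> {..<r}) = e g ` {..<r}" by (auto simp: h_def)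
    then show "I (h (g, x)) = h ` ({g} \<times> {..<r})"
      using I_b(1)[OF gx(1) in_b[OF gx]] e[OF gx(1)] by (simp add: bij_betw_def)
  qed
qed

text \<open>A block with exactly one selected qudit is free: local recovery adds it, as the rest of
  the block is untouched. Only the other blocks are charged to the distance, and there
  \<open>card (P g) \<le> q g\<close>.\<close>

lemma correctable_selection:
  fixes h :: "nat \<times> nat \<Rightarrow> nat" and P :: "nat \<Rightarrow> nat set" and q :: "nat \<Rightarrow> nat"
  assumes code: "qcode a n C D"
    and dec: "\<And>S. S \<subseteq> {..<n} \<Longrightarrow> card S < d \<Longrightarrow> decodes a n C S"
    and loc: "\<And>i. i < n \<Longrightarrow> local_recovery a n C i (I i)"
    and h: "bij_betw h ({..<m} \<times> {..<r}) {..<n}"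
    and I: "\<And>g x. g < m \<Longrightarrow> x < r \<Longrightarrow> I (h (g, x)) = h ` ({g} \<times> {..<r})"
    and P: "\<And>g. g < m \<Longrightarrow> P g \<subseteq> {..<r}" "\<And>g. g < m \<Longrightarrow> card (P g) \<le> max 1 (q g)"
    and q: "(\<Sum>g<m. q g) < max 1 d"
  shows "correctable a {..<n} C (h ` Sigma {..<m} P)"
proof -
  have inj: "inj_on h ({..<m} \<times> {..<r})" and img: "h ` ({..<m} \<times> {..<r}) = {..<n}"
    using h by (auto simp: bij_betw_def)
  define K where "K = {g. g < m \<and> card (P g) \<noteq> 1}"
  have K: "K \<subseteq> {..<m}" by (auto simp: K_def)
  have "finite K" by (rule finite_subset[OF K finite_lessThan])
  have sub: "Sigma S P \<subseteq> {..<m} \<times> {..<r}" if "S \<subseteq> {..<m}" for S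
    using that P(1) by blast
  have finP: "finite (P g)" if "g < m" for g by (rule finite_subset[OF P(1)[OF that] finite_lessThan])
  have "card (h ` Sigma K P) = card (Sigma K P)"
    by (rule card_image[OF inj_on_subset[OF inj sub[OF K]]])
  also have "\<dots> = (\<Sum>g\<in>K. card (P g))"
    using K \<open>finite K\<close> finP by (intro card_SigmaI) auto
  also have "\<dots> \<le> (\<Sum>g\<in>K. q g)"
    using P(2) by (intro sum_mono) (fastforce simp: K_def max_def split: if_splits)
  also have "\<dots> \<le> (\<Sum>g<m. q g)" using K by (intro sum_mono2) auto
  finally have cardK: "card (h ` Sigma K P) < max 1 d" using q by simp
  have subn: "h ` Sigma S P \<subseteq> {..<n}" if "S \<subseteq> {..<m}" for S
    using image_mono[OF sub[OF that], of h] img by simp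
  have base: "correctable a {..<n} C (h ` Sigma K P)"
  \<comment> \<open>The second case occurs only for \<open>d = 0\<close>; the budget
    \<open>max 1 d\<close> then leaves no qudit in the charged blocks.\<close>
  proof (cases "card (h ` Sigma K P) < d")
    case True
    then show ?thesis using decodes_correctable[OF code] subn[OF K] dec by blast
  next
    case False
    then have "card (h ` Sigma K P) = 0" using cardK by linarith
    moreover have "finite (h ` Sigma K P)" by (rule finite_subset[OF subn[OF K] finite_lessThan])
    ultimately have "h ` Sigma K P = {}" by simp
    then show ?thesis by (simp only: correctable_empty)
  qed
  have "correctable a {..<n} C (h ` Sigma (K \<union> Q) P)" if "finite Q" "Q \<subseteq> {..<m} - K" for Q
    using that
  proof (induction Q rule: finite_induct)
    case empty
    then show ?case using base by simp
  next
    case (insert g Q)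
    have g: "g < m" "g \<notin> K \<union> Q" "card (P g) = 1" using insert by (auto simp: K_def)
    then obtain x where x: "P g = {x}" by (auto simp: card_1_singleton_iff)
    then have "x < r" using P(1)[OF g(1)] by simp
    have hn: "h (g, x) < n" using img g(1) \<open>x < r\<close> by blast
    have KQ: "K \<union> Q \<subseteq> {..<m}" using insert K by blast
    have "h ` Sigma (K \<union> Q) P \<inter> h ` ({g} \<times> {..<r}) = h ` (Sigma (K \<union> Q) P \<inter> {g} \<times> {..<r})"
      using g(1) by (intro inj_on_image_Int[OF inj sub[OF KQ], symmetric]) auto
    also have "Sigma (K \<union> Q) P \<inter> {g} \<times> {..<r} = {}" using g(2) by auto
    finally have disj: "h ` Sigma (K \<union> Q) P \<inter> I (h (g, x)) = {}" using I[OF g(1) \<open>x < r\<close>] by simp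
    have "I (h (g, x)) \<subseteq> {..<n}" "h (g, x) \<in> I (h (g, x))"
      using I[OF g(1) \<open>x < r\<close>] img g(1) \<open>x < r\<close> by auto
    moreover have "h ` Sigma (K \<union> Q) P \<subseteq> {..<n} - I (h (g, x))" using subn[OF KQ] disj by blast
    ultimately have "correctable a {..<n} C (h ` Sigma (K \<union> Q) P \<union> {h (g, x)})"
      using insert by (intro local_recovery_correctable[OF code _ _ loc[OF hn]]) auto
    moreover have "h ` Sigma (K \<union> Q) P \<union> {h (g, x)} = h ` Sigma (K \<union> insert g Q) P"
      using x by auto
    ultimately show ?case by simp
  qed
  from this[of "{..<m} - K"] show ?thesis using K by (simp add: Un_absorb1)
qed

section \<open>Counting erasures and the final bound\<close>

text \<open>Greedy filling of \<open>m\<close> blocks of capacity \<open>p\<close>: the truncated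
  difference \<open>e - g * p\<close> is what is left after \<open>g\<close> full blocks.\<close>

lemma sum_min_diff:
  fixes e p :: nat
  shows "(\<Sum>g<m. min p (e - g * p)) = min e (m * p)"
  by (induction m) (auto simp: min_def)

lemma le_of_powr_le_power:
  assumes "2 \<le> a" "real D = real a powr k" "D \<le> a ^ N"
  shows "k \<le> real N"
proof -
  have "real D \<le> real (a ^ N)" using assms(3) by (simp only: of_nat_le_iff)
  then have "real a powr k \<le> real a powr real N" using assms(1,2) by (simp add: powr_realpow)
  then show ?thesis using assms(1) by simp
qed

theorem theorem3p2:
  fixes a n D r d :: nat and k :: real
    and C :: "((nat \<Rightarrow> nat) \<Rightarrow> complex) set" and I :: "nat \<Rightarrow> nat set"
  assumes "a \<ge> 2"
    and "qcode a n C D" and "real D = real a powr k" and "k > 0"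
    and "code_distance a n C d"
    and "qlrc a n C r I"
    and "\<forall>i<n. card (I i) = r"
    and "\<forall>i<n. \<forall>j<n. I i = I j \<or> I i \<inter> I j = {}"
  shows "k \<le> (1 - 2 / real r) * real n
              - 2 * (real d - 1 - real_of_int \<lceil>(real d - 1) / (real r - 1)\<rceil>)"
proof -
  have dec: "decodes a n C S" if "S \<subseteq> {..<n}" "card S < d" for S
    using assms(5) that by (simp add: code_distance_def)
  have loc: "local_recovery a n C i (I i)" if "i < n" for i
    using assms(6) that by (simp add: qlrc_def)
  have "i \<in> I i \<and> I i \<subseteq> {..<n} \<and> card (I i) = r" if "i < n" for i
    using assms(6,7) that by (simp add: qlrc_def)
  from uniform_partition_enumeration[OF this] assms(8)
  obtain m h where n: "n = m * r" and h: "bij_betw h ({..<m} \<times> {..<r}) {..<n}"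
    and I: "\<And>g x. g < m \<Longrightarrow> x < r \<Longrightarrow> I (h (g, x)) = h ` ({g} \<times> {..<r})" by metis
  have inj: "inj_on h ({..<m} \<times> {..<r})" and img: "h ` ({..<m} \<times> {..<r}) = {..<n}"
    using h by (auto simp: bij_betw_def)
  \<comment> \<open>Capacity \<open>r - 1\<close> rather than \<open>r\<close> leaves room in each
    filled block for the single qudit that the other selection takes there. Truncation makes
    \<open>e = 0\<close> when \<open>d = 0\<close>.\<close>
  define p e where "p = r - 1" "e = d - 1"
  \<comment> \<open>\<open>q\<close> spreads \<open>d - 1\<close> global erasures over the first blocks, at most \<open>r - 1\<close> in each; every other
    block contributes one locally recoverable qudit. The second set uses the blocks in reverse order.\<close>
  define q where "q g = min p (e - g * p)" for g
  define \<alpha> where "\<alpha> g = max 1 (q g)" for g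
  have sum_q: "(\<Sum>g<m. q g) = min e (m * p)"
    unfolding q_def by (rule sum_min_diff)
  have rev: "(\<Sum>g<m. f (m - Suc g)) = (\<Sum>g<m. f g)" for f :: "nat \<Rightarrow> nat"
    by (rule sum.nat_diff_reindex)
  have d: "min e (m * p) < max 1 d" by (auto simp: p_e_def)
  have selA: "correctable a {..<n} C (h ` Sigma {..<m} P)"
    if "\<And>g. g < m \<Longrightarrow> P g \<subseteq> {..<r}" "\<And>g. g < m \<Longrightarrow> card (P g) \<le> \<alpha> g" for P
    by (rule correctable_selection[OF assms(2) dec loc h I that(1), where q = q])
       (use that sum_q d in \<open>auto simp: \<alpha>_def\<close>)
  have selB: "correctable a {..<n} C (h ` Sigma {..<m} P)"
    if "\<And>g. g < m \<Longrightarrow> P g \<subseteq> {..<r}" "\<And>g. g < m \<Longrightarrow> card (P g) \<le> \<alpha> (m - Suc g)" for P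
    by (rule correctable_selection[OF assms(2) dec loc h I that(1), where q = "\<lambda>g. q (m - Suc g)"])
       (use that sum_q d in \<open>auto simp: \<alpha>_def rev\<close>)
  have bound: "k \<le> real (card ({..<n} - h ` (Sigma {..<m} P \<union> Sigma {..<m} P')))"
    if "\<And>g. g < m \<Longrightarrow> P g \<subseteq> {..<r}" "\<And>g. g < m \<Longrightarrow> card (P g) \<le> \<alpha> g"
      "\<And>g. g < m \<Longrightarrow> P' g \<subseteq> {..<r}" "\<And>g. g < m \<Longrightarrow> card (P' g) \<le> \<alpha> (m - Suc g)"
      "\<And>g. g < m \<Longrightarrow> P g \<inter> P' g = {}" for P P'
  proof -
    have sub: "Sigma {..<m} P \<subseteq> {..<m} \<times> {..<r}" "Sigma {..<m} P' \<subseteq> {..<m} \<times> {..<r}"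
      using that(1,3) by blast+
    have "h ` Sigma {..<m} P \<inter> h ` Sigma {..<m} P' = h ` (Sigma {..<m} P \<inter> Sigma {..<m} P')"
      by (rule inj_on_image_Int[OF inj sub, symmetric])
    also have "Sigma {..<m} P \<inter> Sigma {..<m} P' = {}" using that(5) by blast
    finally have "h ` Sigma {..<m} P \<inter> h ` Sigma {..<m} P' = {}" by simp
    moreover have "h ` Sigma {..<m} P \<subseteq> {..<n}" "h ` Sigma {..<m} P' \<subseteq> {..<n}"
      using image_mono[OF sub(1), of h] image_mono[OF sub(2), of h] img by simp_all
    ultimately have "D \<le> a ^ card ({..<n} - (h ` Sigma {..<m} P \<union> h ` Sigma {..<m} P'))"
      using that by (intro qcode_singleton_bound[OF assms(2) selA selB]) auto
    from le_of_powr_le_power[OF assms(1,3) this] show ?thesis by (simp only: image_Un)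
  qed
  have \<alpha>_le: "\<alpha> g \<le> max 1 p" for g by (auto simp: \<alpha>_def q_def)
  \<comment> \<open>Erasing nothing gives \<open>k \<le> real n\<close>, so \<open>k > 0\<close>
    excludes an empty register.\<close>
  have "n \<noteq> 0"
    using bound[of "\<lambda>_. {}" "\<lambda>_. {}"] assms(4) by (cases "n = 0") auto
  then have mr: "m > 0" "r > 0" using n by auto
  then have \<alpha>_r: "\<alpha> g \<le> r" for g using \<alpha>_le[of g] by (simp add: p_e_def)
  \<comment> \<open>Otherwise the second set can be trimmed to the complement of the first in every
    block. Together they erase everything, which gives \<open>k \<le> 0\<close>.\<close>
  have "\<not> (\<forall>g<m. r \<le> \<alpha> g + \<alpha> (m - Suc g))"
  proof
    assume cover: "\<forall>g<m. r \<le> \<alpha> g + \<alpha> (m - Suc g)"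
    have "k \<le> real (card ({..<n} - h ` (Sigma {..<m} (\<lambda>g. {..<\<alpha> g}) \<union> Sigma {..<m} (\<lambda>g. {\<alpha> g..<r}))))"
      using \<alpha>_r cover by (intro bound) (auto simp: le_diff_conv intro: order_less_le_trans)
    also have "Sigma {..<m} (\<lambda>g. {..<\<alpha> g}) \<union> Sigma {..<m} (\<lambda>g. {\<alpha> g..<r}) = {..<m} \<times> {..<r}"
      using \<alpha>_r by (auto intro: order_less_le_trans)
    finally show False using img assms(4) by simp
  qed
  \<comment> \<open>In a block \<open>g0\<close> that is not exhausted, both fillings end, so the two selections overlap in no block.\<close>
  then obtain g0 where g0: "g0 < m" "\<alpha> g0 + \<alpha> (m - Suc g0) < r" by (auto simp: not_le)
  have "p \<ge> 2" using g0 by (auto simp: p_e_def \<alpha>_def)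
  \<comment> \<open>A block that is not filled up to \<open>p\<close> is one by whose end the
    \<open>e\<close> erasures have run out.\<close>
  have less_p: "e < Suc g * p" if "\<alpha> g < p" for g
    using that by (auto simp: \<alpha>_def q_def min_def split: if_splits)
  have \<alpha>_1: "\<alpha> g = 1" if "e \<le> g * p" for g using that by (simp add: \<alpha>_def q_def)
  have ge1: "1 \<le> \<alpha> g" for g by (simp add: \<alpha>_def)
  have e0: "e < Suc g0 * p" "e < (m - g0) * p"
  proof -
    show "e < Suc g0 * p" by (rule less_p) (use g0(2) ge1[of "m - Suc g0"] in \<open>simp add: p_e_def\<close>)
    have "e < Suc (m - Suc g0) * p" by (rule less_p) (use g0(2) ge1[of g0] in \<open>simp add: p_e_def\<close>)
    then show "e < (m - g0) * p" using g0(1) by (simp add: Suc_diff_Suc)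
  qed
  have "Suc g0 * p \<le> m * p" using g0(1) by (intro mult_le_mono1) simp
  then have e_le: "e \<le> m * p" using e0(1) by linarith
  \<comment> \<open>In blocks before \<open>g0\<close> the reversed filling has run out, and after
    \<open>g0\<close> the forward one has. So one summand is 1 and the other at most
    \<open>r - 1\<close>.\<close>
  have no_conflict: "\<alpha> g + \<alpha> (m - Suc g) \<le> r" if "g < m" for g
  proof (cases g g0 rule: linorder_cases)
    case less
    have "(m - g0) * p \<le> (m - Suc g) * p" using less by (intro mult_le_mono1) simp
    then have "\<alpha> (m - Suc g) = 1" using e0(2) by (intro \<alpha>_1) linarith
    then show ?thesis using \<alpha>_le[of g] \<open>p \<ge> 2\<close> by (simp add: p_e_def)
  next
    case equal
    then show ?thesis using g0 by simp
  next
    case greater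
    have "Suc g0 * p \<le> g * p" using greater by (intro mult_le_mono1) simp
    then have "\<alpha> g = 1" using e0(1) by (intro \<alpha>_1) linarith
    then show ?thesis using \<alpha>_le[of "m - Suc g"] \<open>p \<ge> 2\<close> by (simp add: p_e_def)
  qed
  \<comment> \<open>The forward set takes positions from the left end of a block, the reversed one
    from the right end, and \<open>no_conflict\<close> keeps them apart.\<close>
  let ?P = "Sigma {..<m} (\<lambda>g. {..<\<alpha> g})" and ?P' = "Sigma {..<m} (\<lambda>g. {r - \<alpha> (m - Suc g)..<r})"
  have sub: "?P \<union> ?P' \<subseteq> {..<m} \<times> {..<r}" using \<alpha>_r by (auto intro: order_less_le_trans)
  have disjP: "?P \<inter> ?P' = {}"
  proof -
    have False if "g < m" "x < \<alpha> g" "r - \<alpha> (m - Suc g) \<le> x" for g x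
      using that no_conflict[OF that(1)] by linarith
    then show ?thesis by auto
  qed
  have k: "k \<le> real (card ({..<n} - h ` (?P \<union> ?P')))"
  proof (rule bound)
    fix g assume g: "g < m"
    show "{..<\<alpha> g} \<inter> {r - \<alpha> (m - Suc g)..<r} = {}" using no_conflict[OF g] by auto
  qed (use \<alpha>_r in \<open>auto intro: order_less_le_trans\<close>)
  have "card (h ` (?P \<union> ?P')) = card (?P \<union> ?P')"
    by (rule card_image[OF inj_on_subset[OF inj sub]])
  also have "\<dots> = card ?P + card ?P'"
    using disjP by (intro card_Un_disjoint) auto
  also have "\<dots> = (\<Sum>g<m. \<alpha> g) + (\<Sum>g<m. \<alpha> (m - Suc g))"
    using \<alpha>_r by simp
  finally have card2: "card (h ` (?P \<union> ?P')) = 2 * (\<Sum>g<m. \<alpha> g)" by (simp add: rev)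
  have "h ` (?P \<union> ?P') \<subseteq> {..<n}" using image_mono[OF sub, of h] img by simp
  then have "card ({..<n} - h ` (?P \<union> ?P')) = n - 2 * (\<Sum>g<m. \<alpha> g)" "2 * (\<Sum>g<m. \<alpha> g) \<le> n"
    using card_Diff_subset[of "h ` (?P \<union> ?P')" "{..<n}"] card_mono[of "{..<n}" "h ` (?P \<union> ?P')"] card2
    by (auto simp: finite_subset)
  then have k_le: "k \<le> real n - 2 * real (\<Sum>g<m. \<alpha> g)" using k by (simp add: of_nat_diff)
  define t where "t = nat \<lceil>real e / real p\<rceil>"
  have t: "real t = of_int \<lceil>real e / real p\<rceil>" by (simp add: t_def)
  have "real e / real p \<le> real t" unfolding t by (rule le_of_int_ceiling)
  then have "real e \<le> real t * real p" using \<open>p \<ge> 2\<close> by (simp add: divide_le_eq)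
  then have et: "e \<le> t * p" by (simp flip: of_nat_mult)
  \<comment> \<open>The first \<open>t\<close> blocks can hold all \<open>e\<close> erasures, so
    every block from \<open>t\<close> on has \<open>q g = 0\<close> and contributes its one free
    qudit.\<close>
  have "e + (m - t) = (\<Sum>g<m. q g) + (\<Sum>g<m. if t \<le> g then 1 else 0)"
  proof -
    have "(\<Sum>g<m. if t \<le> g then 1 else 0) = card {g \<in> {..<m}. t \<le> g}"
      by (simp add: sum.If_cases Int_def)
    also have "{g \<in> {..<m}. t \<le> g} = {t..<m}" by auto
    finally show ?thesis using sum_q e_le by simp
  qed
  also have "\<dots> = (\<Sum>g<m. q g + (if t \<le> g then 1 else 0))" by (simp add: sum.distrib)
  also have "\<dots> \<le> (\<Sum>g<m. \<alpha> g)"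
  proof (rule sum_mono)
    fix g
    have "q g = 0" if "t \<le> g"
      using order_trans[OF et mult_le_mono1[OF that]] by (simp add: q_def)
    then show "q g + (if t \<le> g then 1 else 0) \<le> \<alpha> g" by (auto simp: \<alpha>_def)
  qed
  finally have sum_\<alpha>: "real e + real m - real t \<le> real (\<Sum>g<m. \<alpha> g)" by linarith
  \<comment> \<open>For \<open>d = 0\<close> the truncated \<open>e\<close> is 0 instead of -1; the
    ceiling is then at least -1, which covers the difference.\<close>
  have excess: "real d - 1 - real_of_int \<lceil>(real d - 1) / (real r - 1)\<rceil> \<le> real e - real t"
  proof (cases "d = 0")
    case True
    have "- 1 \<le> \<lceil>(real d - 1) / (real r - 1)\<rceil>"
      using True \<open>p \<ge> 2\<close> by (simp add: le_ceiling_iff p_e_def divide_simps)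
    then have "- 1 \<le> real_of_int \<lceil>(real d - 1) / (real r - 1)\<rceil>" by linarith
    then show ?thesis using True by (simp add: t p_e_def)
  next
    case False
    then show ?thesis unfolding t using mr(2) by (simp add: p_e_def of_nat_diff)
  qed
  have rate: "(1 - 2 / real r) * real n = real n - 2 * real m"
    using mr n by (simp add: field_simps)
  have "k \<le> x - 2 * z"
    if "u + v - w \<le> s" "z \<le> u - w" "x = y - 2 * v" "k \<le> y - 2 * s" for s u v w x y z :: real
    using that by linarith
  from this[OF sum_\<alpha> excess rate k_le] show ?thesis .
qed

end
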